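(* Let $(Y,q)$ be a smoothable Gorenstein curve singularity with $\mathbb G_m$-action. Then the weights of the $\mathbb G_m$-action on the space of differential one-forms of $Y$ can determine those of higher-order differentials of $Y$.
   Context: Everything is over $\mathbb C$. $(Y,q)$ is an isolated reduced curve singularity with good $\mathbb G_m$-action, i.e. all weights on the maximal ideal of $\widehat{\mathcal O}_{Y,q}$ have the same sign. $Y$ also denotes the projectivization, obtained by adding one smooth point at infinity $y_i$ to each of the $n$ rational branches $Y_i$ of $Y$. Let $\omega_Y$ be the dualizing bundle and $\omega_Y^{\log}=\omega_Y(\sum_i y_i)$ its log version. Differentials of order $m$ on $Y$ are sections of the $m$-th power of the dualizing bundle (or of its log version, when logarithmic poles at the points at infinity are allowed); one-forms are the case $m=1$ and higher-order differentials the cases $m\ge2$. The scaling convention for the $\mathbb G_m$-action is as follows: if a local generator of $\omega_Y$ at $q$ restricts on the normalization of $Y_i$, with uniformizer $t_i$ at $q$, to $dt_i/t_i^{m_i+2}$ up to a scalar, then with $\ell=\mathrm{lcm}(m_1+1,\dots,m_n+1)$ and $a_i=\ell/(m_i+1)$ the action is $\lambda\cdot t_i=\lambda^{-a_i}t_i$. Weights are counted with multiplicity. *)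

theory Defs
  imports
    "HOL-Computational_Algebra.Formal_Laurent_Series"
    "HOL-Library.Function_Algebras"
    "HOL-Algebra.RingHom"
begin

unbundle fps_syntax

section \<open>Reduced curve singularities\<close>

text \<open>
  The complete local ring of a reduced curve singularity over the complex numbers whose branches are
  indexed by the finite type \<open>'b\<close> is given inside its normalization, the product of the power
  series rings \<open>\<complex>[[t\<^sub>i]]\<close>, and hence inside its total ring of fractions, the product of the
  fields \<open>\<complex>((t\<^sub>i))\<close>.  All algebraic operations on tuples are pointwise.
\<close>

type_synonym 'b germ = "'b \<Rightarrow> complex fls"

definition const_germ :: "complex \<Rightarrow> 'b germ" where
  "const_germ c = (\<lambda>i. fls_const c)"

definition normalization_ring :: "'b germ set" where
  "normalization_ring = {f. \<forall>i. f i \<in> range fps_to_fls}"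

text \<open>
  The conditions say that \<open>R\<close> is a subalgebra of the normalization, that all branches pass through
  the one point \<open>q\<close>, that the conductor contains a power of every \<open>t\<^sub>i\<close> (equivalently, the
  \<open>\<delta>\<close>-invariant is finite), and that \<open>q\<close> is not a smooth point.
\<close>

definition curve_singularity :: "('b::finite) germ set \<Rightarrow> bool" where
  "curve_singularity R \<longleftrightarrow>
     R \<subseteq> normalization_ring \<and>
     range const_germ \<subseteq> R \<and>
     (\<forall>f\<in>R. \<forall>g\<in>R. f + g \<in> R \<and> f * g \<in> R) \<and>
     (\<forall>f\<in>R. \<forall>i j. f i $$ 0 = f j $$ 0) \<and>
     (\<exists>N::int. \<forall>f. (\<forall>i k. k < N \<longrightarrow> f i $$ k = 0) \<longrightarrow> f \<in> R) \<and>
     R \<noteq> normalization_ring"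

definition max_ideal :: "'b germ set \<Rightarrow> 'b germ set" where
  "max_ideal R = {f \<in> R. \<forall>i. f i $$ 0 = 0}"

section \<open>The dualizing module\<close>

text \<open>
  A tuple \<open>h\<close> also stands for the meromorphic differential \<open>h\<^sub>i (dt\<^sub>i)\<^sup>m\<close> of order \<open>m\<close> on the
  normalization.  The dualizing module is described by Rosenlicht's regular differentials, with
  \<open>m = 1\<close>.
\<close>

definition dualizing_module :: "('b::finite) germ set \<Rightarrow> 'b germ set" where
  "dualizing_module R = {\<eta>. \<forall>f\<in>R. (\<Sum>i\<in>UNIV. fls_residue (f i * \<eta> i)) = 0}"

definition dualizing_generator :: "('b::finite) germ set \<Rightarrow> 'b germ \<Rightarrow> bool" where
  "dualizing_generator R \<eta> \<longleftrightarrow> dualizing_module R = (\<lambda>f. f * \<eta>) ` R"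

definition gorenstein :: "('b::finite) germ set \<Rightarrow> bool" where
  "gorenstein R \<longleftrightarrow> (\<exists>\<eta>. dualizing_generator R \<eta>)"

primrec dualizing_power :: "('b::finite) germ set \<Rightarrow> nat \<Rightarrow> 'b germ set" where
  "dualizing_power R 0 = R"
| "dualizing_power R (Suc m) =
     {\<Sum>j<N. \<alpha> j * \<beta> j | (N::nat) \<alpha> \<beta>.
        \<forall>j<N. \<alpha> j \<in> dualizing_module R \<and> \<beta> j \<in> dualizing_power R m}"

section \<open>The action of the multiplicative group\<close>

text \<open>The substitution \<open>f(t) \<mapsto> f(ct)\<close>.\<close>

definition fls_rescale :: "complex \<Rightarrow> complex fls \<Rightarrow> complex fls" where
  "fls_rescale c f = Abs_fls (\<lambda>k. c powi k * f $$ k)"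

text \<open>
  The action \<open>\<lambda> \<cdot> t\<^sub>i = \<lambda>\<^bsup>w i\<^esup> t\<^sub>i\<close> on differentials of order \<open>m\<close>, where
  \<open>\<lambda> \<cdot> (dt\<^sub>i)\<^sup>m = \<lambda>\<^bsup>m w i\<^esup> (dt\<^sub>i)\<^sup>m\<close>.  Functions are the case \<open>m = 0\<close>.
\<close>

definition Gm_act :: "('b \<Rightarrow> int) \<Rightarrow> nat \<Rightarrow> complex \<Rightarrow> 'b germ \<Rightarrow> 'b germ" where
  "Gm_act w m z h = (\<lambda>i. fls_const ((z powi w i) ^ m) * fls_rescale (z powi w i) (h i))"

definition weight_space ::
    "('b \<Rightarrow> int) \<Rightarrow> nat \<Rightarrow> 'b germ set \<Rightarrow> int \<Rightarrow> 'b germ set" where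
  "weight_space w m V k =
     {h \<in> V. \<forall>z. z \<noteq> 0 \<longrightarrow> Gm_act w m z h = const_germ (z powi k) * h}"

definition good_Gm_action :: "'b germ set \<Rightarrow> ('b \<Rightarrow> int) \<Rightarrow> bool" where
  "good_Gm_action R w \<longleftrightarrow>
     (\<forall>z. z \<noteq> 0 \<longrightarrow> Gm_act w 0 z ` R \<subseteq> R) \<and>
     ((\<forall>k. weight_space w 0 (max_ideal R) k \<noteq> {0} \<longrightarrow> k > 0) \<or>
      (\<forall>k. weight_space w 0 (max_ideal R) k \<noteq> {0} \<longrightarrow> k < 0))"

text \<open>
  The integer \<open>m\<^sub>i\<close> of a generator that is \<open>dt\<^sub>i/t\<^sub>i\<^bsup>m\<^sub>i+2\<^esup>\<close> up to a unit on the branch \<open>i\<close>; two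
  generators differ by a unit of \<open>R\<close>, so it does not depend on the generator.
\<close>

definition branch_order :: "'b germ \<Rightarrow> 'b \<Rightarrow> int" where
  "branch_order \<eta> i = - fls_subdegree (\<eta> i) - 2"

text \<open>
  The node has \<open>m\<^sub>i = -1\<close> on both branches; the convention then gives weights \<open>0\<close>, so that together
  with \<open>good_Gm_action\<close> it excludes the node, for which \<open>\<ell>/(m\<^sub>i+1)\<close> has no meaning.
\<close>

definition scaling_convention :: "('b::finite) germ set \<Rightarrow> ('b \<Rightarrow> int) \<Rightarrow> bool" where
  "scaling_convention R w \<longleftrightarrow>
     (\<exists>\<eta>. dualizing_generator R \<eta> \<and>
        (let l = Lcm (range (\<lambda>i. branch_order \<eta> i + 1))
         in \<forall>i. w i = - (l div (branch_order \<eta> i + 1))))"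

section \<open>Differentials on the projective curve\<close>

text \<open>
  The projective curve has normalization a disjoint union of projective lines with coordinates
  \<open>t\<^sub>i\<close>, and \<open>y\<^sub>i\<close> is \<open>t\<^sub>i = \<infinity>\<close>.  With \<open>t = 1/s\<close> one has
  \<open>t\<^sup>k (dt)\<^sup>m = (-1)\<^sup>m s\<^bsup>-k-2m\<^esup> (ds)\<^sup>m\<close>.  A global section is regular away from \<open>t\<^sub>i = 0\<close> and \<open>y\<^sub>i\<close>,
  hence a tuple of Laurent polynomials; these are exactly the Laurent series with bounded pole order
  at infinity.
\<close>

definition pole_order_at_infinity_le :: "nat \<Rightarrow> nat \<Rightarrow> 'b germ \<Rightarrow> bool" where
  "pole_order_at_infinity_le m p h \<longleftrightarrow>
     (\<forall>i k. h i $$ k \<noteq> 0 \<longrightarrow> - k - 2 * int m \<ge> - int p)"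

text \<open>Global sections of the \<open>m\<close>-th powers of \<open>\<omega>\<^sub>Y\<close> and of \<open>\<omega>\<^sub>Y(\<Sum> y\<^sub>i)\<close>.\<close>

definition differentials :: "('b::finite) germ set \<Rightarrow> nat \<Rightarrow> 'b germ set" where
  "differentials R m = {h \<in> dualizing_power R m. pole_order_at_infinity_le m 0 h}"

definition log_differentials :: "('b::finite) germ set \<Rightarrow> nat \<Rightarrow> 'b germ set" where
  "log_differentials R m = {h \<in> dualizing_power R m. pole_order_at_infinity_le m m h}"

definition weight_multiplicity ::
    "('b \<Rightarrow> int) \<Rightarrow> nat \<Rightarrow> 'b germ set \<Rightarrow> int \<Rightarrow> nat" where
  "weight_multiplicity w m V k =
     vector_space.dim (\<lambda>c h. const_germ c * h) (weight_space w m V k)"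

section \<open>Smoothability\<close>

definition class_ring :: "('r::comm_ring_1) set \<Rightarrow> 'r ring" where
  "class_ring S = \<lparr>carrier = S, monoid.mult = (*), one = 1, zero = 0, add = (+)\<rparr>"

definition prime_chain :: "('r, 'm) ring_scheme \<Rightarrow> 'r set \<Rightarrow> nat \<Rightarrow> bool" where
  "prime_chain A P h \<longleftrightarrow>
     (\<exists>p. (\<forall>i\<le>h. primeideal (p i) A) \<and> (\<forall>i<h. p i \<subset> p (Suc i)) \<and> p h = P)"

definition has_height :: "('r, 'm) ring_scheme \<Rightarrow> 'r set \<Rightarrow> nat \<Rightarrow> bool" where
  "has_height A P h \<longleftrightarrow> prime_chain A P h \<and> (\<forall>h'. prime_chain A P h' \<longrightarrow> h' \<le> h)"

text \<open>
  The localization of \<open>A\<close> at \<open>P\<close> is regular: its maximal ideal is generated by as many elements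
  as its dimension.  The generators can be taken in \<open>P\<close>, and denominators are cleared.
\<close>

definition regular_at :: "('r, 'm) ring_scheme \<Rightarrow> 'r set \<Rightarrow> bool" where
  "regular_at A P \<longleftrightarrow>
     (\<exists>xs. set xs \<subseteq> P \<and> has_height A P (length xs) \<and>
        (\<forall>x\<in>P. \<exists>u \<in> carrier A - P. u \<otimes>\<^bsub>A\<^esub> x \<in> Idl\<^bsub>A\<^esub> (set xs)))"

definition adically_complete :: "('r, 'm) ring_scheme \<Rightarrow> 'r \<Rightarrow> bool" where
  "adically_complete A s \<longleftrightarrow>
     (\<forall>a::nat \<Rightarrow> 'r.
        (\<forall>k. a k \<in> carrier A) \<and> (\<forall>k. a (Suc k) \<ominus>\<^bsub>A\<^esub> a k \<in> PIdl\<^bsub>A\<^esub> (s [^]\<^bsub>A\<^esub> k)) \<longrightarrow>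
        (\<exists>!x. x \<in> carrier A \<and> (\<forall>k. x \<ominus>\<^bsub>A\<^esub> a k \<in> PIdl\<^bsub>A\<^esub> (s [^]\<^bsub>A\<^esub> k))))"

text \<open>
  A one-parameter smoothing over the formal disc: a flat (that is, torsion-free) complete algebra
  \<open>A\<close> over \<open>\<complex>[[s]]\<close>, with structure map \<open>\<iota>\<close>, whose special fibre is identified with
  \<open>R\<close> by \<open>\<pi>\<close>, and whose generic fibre \<open>A[1/s]\<close> is regular.  The fraction field of \<open>\<complex>[[s]]\<close> has
  characteristic zero, so regularity is smoothness.
\<close>

definition smoothing ::
    "'r ring \<Rightarrow> (complex fps \<Rightarrow> 'r) \<Rightarrow> ('r \<Rightarrow> 'b germ) \<Rightarrow> ('b::finite) germ set \<Rightarrow> bool" where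
  "smoothing A \<iota> \<pi> R \<longleftrightarrow>
     cring A \<and>
     \<iota> \<in> ring_hom (class_ring UNIV) A \<and>
     (\<forall>c. \<forall>a\<in>carrier A. \<iota> c \<otimes>\<^bsub>A\<^esub> a = \<zero>\<^bsub>A\<^esub> \<longrightarrow> c = 0 \<or> a = \<zero>\<^bsub>A\<^esub>) \<and>
     adically_complete A (\<iota> fps_X) \<and>
     \<pi> \<in> ring_hom A (class_ring R) \<and>
     \<pi> ` carrier A = R \<and>
     a_kernel A (class_ring R) \<pi> = PIdl\<^bsub>A\<^esub> (\<iota> fps_X) \<and>
     (\<forall>c. \<pi> (\<iota> (fps_const c)) = const_germ c) \<and>
     (\<forall>P. primeideal P A \<and> \<iota> fps_X \<notin> P \<longrightarrow> regular_at A P)"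

text \<open>
  Fixing the type of the elements of \<open>A\<close> loses no generality: by flatness and completeness
  \<open>A\<close> is, as a \<open>\<complex>[[s]]\<close>-module, isomorphic to \<open>R[[s]]\<close>.
\<close>

definition smoothable :: "('b::finite) germ set \<Rightarrow> bool" where
  "smoothable R \<longleftrightarrow> (\<exists>(A :: (nat \<Rightarrow> 'b germ) ring) \<iota> \<pi>. smoothing A \<iota> \<pi> R)"

section \<open>The singularities under consideration\<close>

definition smoothable_gorenstein_Gm ::
    "('b::finite) germ set \<Rightarrow> ('b \<Rightarrow> int) \<Rightarrow> bool" where
  "smoothable_gorenstein_Gm R w \<longleftrightarrow>
     curve_singularity R \<and> smoothable R \<and> gorenstein R \<and>
     good_Gm_action R w \<and> scaling_convention R w"

end

theory Submission
  imports Defs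
begin

text \<open>
  Let \<open>w i = - b i\<close> be the weight of \<open>t\<^sub>i\<close>.  The scaling convention says that the leading terms of a
  generator \<open>\<eta>\<close> of the dualizing module all have the same weight \<open>l > 0\<close>.  Because the ring and its
  dualizing module are stable under the action, these leading terms form again a generator \<open>\<eta>0\<close>, of
  weight \<open>l\<close> (\<open>\<eta>0_generates\<close>).  Hence a differential of order \<open>m\<close> and weight \<open>k\<close> is \<open>\<eta>0\<^sup>m\<close> times a
  homogeneous function of degree \<open>j = m l - k\<close>, where \<open>t\<^sub>i\<close> has degree \<open>b i\<close>, subject to a condition at
  infinity: \<open>k \<ge> 0\<close> for logarithmic and \<open>k \<ge> m b i\<close> on the branch \<open>i\<close> for regular differentials
  (\<open>weight_multiplicity_eq\<close>).

  Let \<open>d j\<close> be the dimension of the space of homogeneous functions of degree \<open>j\<close>, and \<open>r j\<close> the number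
  of branches with \<open>b i\<close> dividing \<open>j\<close>.  The residue pairing makes the degrees \<open>j\<close> and \<open>l - j\<close>
  annihilators of each other inside the homogeneous tuples on the normalization, so
  \<open>d j + d (l - j) = r j\<close> (\<open>dim_dual\<close>).  Moreover \<open>d 0 = 1\<close>, and \<open>d j = 0\<close> for \<open>j < 0\<close>; and \<open>r\<close> has the
  period \<open>l\<close> because every \<open>b i\<close> divides \<open>l\<close>.  The largest weight of a one-form is \<open>l\<close>.

  Logarithmic one-forms show \<open>d j\<close> for \<open>0 \<le> j \<le> l\<close>, hence all \<open>r j\<close>, hence all \<open>d j\<close>
  (\<open>log_dims_determined\<close>).  Regular one-forms show \<open>d j\<close> for \<open>0 \<le> j < l\<close> only, hence \<open>r j\<close> for
  \<open>0 < j < l\<close> and, by inversion over divisors, the number of branches with any given \<open>b i < l\<close>.  The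
  number of branches with \<open>b i = l\<close> cannot be seen, but it does not matter: a regular differential of
  order \<open>m \<ge> 2\<close> and degree \<open>j > 0\<close> vanishes on those branches.  The remaining conditions at infinity
  are automatic for \<open>j < l\<close>, they leave a hyperplane in the functions on the branches with \<open>b i < l\<close>
  for \<open>j = l\<close>, and for \<open>j > l\<close> the multiplicity is the number of branches with \<open>b i\<close> dividing \<open>j\<close> and
  \<open>m b i \<le> m l - j\<close> (\<open>regular_dims_determined\<close>).
\<close>

section \<open>Dimensions from dual families\<close>

text \<open>
  If functionals \<open>\<chi> p\<close> separate the vectors of a subspace \<open>H\<close> and \<open>u\<close> is a family in \<open>H\<close> dual to
  them, then \<open>u\<close> is a basis of \<open>H\<close> and the \<open>\<chi> p\<close> are the coordinates: the difference between \<open>h\<close>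
  and its expansion is killed by every \<open>\<chi> p\<close>.  All dimensions below are computed in this way,
  since the spaces of germs that occur live in infinite-dimensional ambient spaces.
\<close>

lemma (in vector_space) dual_family_expansion:
  assumes H: "subspace H" and P: "finite P"
    and add: "\<And>p x y. p \<in> P \<Longrightarrow> \<chi> p (x + y) = \<chi> p x + \<chi> p y"
    and hom: "\<And>p c x. p \<in> P \<Longrightarrow> \<chi> p (c *s x) = c * \<chi> p x"
    and u: "\<And>p. p \<in> P \<Longrightarrow> u p \<in> H"
    and dual: "\<And>p q. p \<in> P \<Longrightarrow> q \<in> P \<Longrightarrow> \<chi> q (u p) = (if p = q then 1 else 0)"
    and sep: "\<And>h. h \<in> H \<Longrightarrow> (\<And>p. p \<in> P \<Longrightarrow> \<chi> p h = 0) \<Longrightarrow> h = 0"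
    and h: "h \<in> H"
  shows "h = (\<Sum>p\<in>P. \<chi> p h *s u p)"
proof -
  have additive: "additive (\<chi> p)" if "p \<in> P" for p
    by (simp add: additive_def add[OF that])
  define s where "s = (\<Sum>p\<in>P. \<chi> p h *s u p)"
  have "s \<in> H"
    unfolding s_def by (intro subspace_sum[OF H] subspace_scale[OF H] u)
  have "h - s = 0"
  proof (rule sep)
    show "h - s \<in> H"
      using H h \<open>s \<in> H\<close> by (rule subspace_diff)
    fix q assume q: "q \<in> P"
    have "\<chi> q s = (\<Sum>p\<in>P. \<chi> p h * (if p = q then 1 else 0))"
      unfolding s_def additive.sum[OF additive[OF q]] using q by (intro sum.cong) (auto simp: hom dual)
    also have "\<dots> = \<chi> q h"
      using P q by (simp add: if_distrib cong: if_cong)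
    finally show "\<chi> q (h - s) = 0"
      by (simp add: additive.diff[OF additive[OF q]])
  qed
  then show ?thesis
    by (simp add: s_def)
qed

lemma (in vector_space) dim_eq_card_dual_family:
  assumes H: "subspace H" and P: "finite P"
    and add: "\<And>p x y. p \<in> P \<Longrightarrow> \<chi> p (x + y) = \<chi> p x + \<chi> p y"
    and hom: "\<And>p c x. p \<in> P \<Longrightarrow> \<chi> p (c *s x) = c * \<chi> p x"
    and u: "\<And>p. p \<in> P \<Longrightarrow> u p \<in> H"
    and dual: "\<And>p q. p \<in> P \<Longrightarrow> q \<in> P \<Longrightarrow> \<chi> q (u p) = (if p = q then 1 else 0)"
    and sep: "\<And>h. h \<in> H \<Longrightarrow> (\<And>p. p \<in> P \<Longrightarrow> \<chi> p h = 0) \<Longrightarrow> h = 0"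
  shows "dim H = card P"
proof -
  have inj: "inj_on u P"
    by (intro inj_onI) (metis dual zero_neq_one)
  have additive: "additive (\<chi> p)" if "p \<in> P" for p
    by (simp add: additive_def add[OF that])
  show ?thesis
  proof (rule dim_unique)
    show "u ` P \<subseteq> H"
      using u by blast
    show "H \<subseteq> span (u ` P)"
    proof
      fix h assume "h \<in> H"
      then have "h = (\<Sum>p\<in>P. \<chi> p h *s u p)"
        using dual_family_expansion[OF H P add hom u dual sep] by blast
      also have "\<dots> \<in> span (u ` P)"
        by (intro span_sum span_scale span_base imageI)
      finally show "h \<in> span (u ` P)" .
    qed
    show "card (u ` P) = card P"
      using inj by (rule card_image)
    show "independent (u ` P)"
    proof
      assume "dependent (u ` P)"
      then obtain y where y: "\<exists>v\<in>u ` P. y v \<noteq> 0" "(\<Sum>v\<in>u ` P. y v *s v) = 0"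
        using dependent_finite[of "u ` P"] P by blast
      then obtain q where q: "q \<in> P" "y (u q) \<noteq> 0"
        by blast
      have "0 = \<chi> q (\<Sum>p\<in>P. y (u p) *s u p)"
        using y(2) by (simp add: sum.reindex[OF inj] additive.zero[OF additive[OF q(1)]])
      also have "\<dots> = (\<Sum>p\<in>P. y (u p) * (if p = q then 1 else 0))"
        unfolding additive.sum[OF additive[OF q(1)]] using q by (intro sum.cong) (auto simp: hom dual)
      also have "\<dots> = y (u q)"
        using P q by (simp add: if_distrib cong: if_cong)
      finally show False
        using q by simp
    qed
  qed
qed

interpretation coord: vector_space "\<lambda>(c::complex) (f::'a \<Rightarrow> complex) i. c * f i"
  by unfold_locales (auto simp: fun_eq_iff algebra_simps)

lemma sum_fun_apply: "(\<Sum>p\<in>P. g p) i = (\<Sum>p\<in>P. g p i)" for g :: "'p \<Rightarrow> 'a \<Rightarrow> 'c::comm_monoid_add"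
  by (induction P rule: infinite_finite_induct) auto

text \<open>
  Gaussian elimination: a space of coordinate vectors has a reduced echelon basis \<open>u\<close>, which is dual
  to the coordinates at the set \<open>P\<close> of pivots.
\<close>

lemma pivots_exist:
  fixes W :: "('a \<Rightarrow> complex) set"
  assumes "coord.subspace W" and "finite S" and "\<And>a i. a \<in> W \<Longrightarrow> a i \<noteq> 0 \<Longrightarrow> i \<in> S"
  shows "\<exists>P u. P \<subseteq> S \<and> (\<forall>p\<in>P. u p \<in> W) \<and> (\<forall>p\<in>P. \<forall>q\<in>P. u p q = (if p = q then 1 else 0)) \<and>
    (\<forall>a\<in>W. (\<forall>p\<in>P. a p = 0) \<longrightarrow> a = 0)"
  using assms(2,1,3)
proof (induction S arbitrary: W rule: finite_induct)
  case empty
  then have "\<forall>a\<in>W. a = 0"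
    by (auto simp: fun_eq_iff)
  then show ?case
    by (intro exI[of _ "{}"]) (simp del: zero_fun_apply add: zero_fun_def)
next
  case (insert s S)
  define W' where "W' = {a \<in> W. a s = 0}"
  have sub': "coord.subspace W'"
    using insert.prems(1) unfolding coord.subspace_def W'_def by auto
  have "\<exists>P u. P \<subseteq> S \<and> (\<forall>p\<in>P. u p \<in> W') \<and> (\<forall>p\<in>P. \<forall>q\<in>P. u p q = (if p = q then 1 else 0)) \<and>
      (\<forall>a\<in>W'. (\<forall>p\<in>P. a p = 0) \<longrightarrow> a = 0)"
    by (rule insert.IH[OF sub']) (use insert.prems(2) in \<open>auto simp: W'_def\<close>)
  then obtain P u where P: "P \<subseteq> S" and raw: "\<forall>p\<in>P. u p \<in> W'"
      "\<forall>p\<in>P. \<forall>q\<in>P. u p q = (if p = q then 1 else 0)"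
      "\<forall>a\<in>W'. (\<forall>p\<in>P. a p = 0) \<longrightarrow> a = 0"
    by - (elim exE conjE, rule that)
  have uW': "u p \<in> W'" and dual: "q \<in> P \<Longrightarrow> u p q = (if p = q then 1 else 0)" if "p \<in> P" for p q
    using that raw by blast+
  have sep: "a = 0" if "a \<in> W'" "\<And>p. p \<in> P \<Longrightarrow> a p = 0" for a
    using that raw(3) by blast
  have finP: "finite P"
    using P insert.hyps(1) by (rule finite_subset)
  have snP: "s \<notin> P"
    using P insert.hyps(2) by blast
  show ?case
  proof (cases "\<exists>v\<in>W. v s \<noteq> 0")
    case False
    then have "W' = W"
      by (auto simp: W'_def)
    then show ?thesis
      using P raw by (intro exI[of _ P] exI[of _ u] conjI) blast+
  next
    case True
    then obtain v where v: "v \<in> W" "v s \<noteq> 0" by blast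
    \<comment> \<open>normalise \<open>v\<close> at \<open>s\<close> and clear its entries at the old pivots\<close>
    define v' where "v' = (\<lambda>i. (1 / v s) * (v i - (\<Sum>p\<in>P. v p * u p i)))"
    have us: "u p s = 0" if "p \<in> P" for p
      using uW'[OF that] by (simp add: W'_def)
    have uW: "u p \<in> W" if "p \<in> P" for p
      using uW'[OF that] by (simp add: W'_def)
    have "v - (\<Sum>p\<in>P. (\<lambda>i. v p * u p i)) \<in> W"
      by (intro coord.subspace_diff coord.subspace_sum insert.prems(1) v
          coord.subspace_scale uW)
    then have "(\<lambda>i. (1 / v s) * (v - (\<Sum>p\<in>P. (\<lambda>i. v p * u p i))) i) \<in> W"
      by (rule coord.subspace_scale[OF insert.prems(1)])
    moreover have "(\<lambda>i. (1 / v s) * (v - (\<Sum>p\<in>P. (\<lambda>i. v p * u p i))) i) = v'"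
      by (simp add: v'_def fun_eq_iff sum_fun_apply)
    ultimately have v'W: "v' \<in> W" by simp
    have v's: "v' s = 1"
      using v(2) by (simp add: v'_def us)
    have v'P: "v' q = 0" if q: "q \<in> P" for q
    proof -
      have "(\<Sum>p\<in>P. v p * u p q) = (\<Sum>p\<in>P. v p * (if p = q then 1 else 0))"
        using q by (intro sum.cong) (auto simp: dual)
      also have "\<dots> = v q"
        using finP q by (simp add: if_distrib cong: if_cong)
      finally show ?thesis
        by (simp add: v'_def)
    qed
    show ?thesis
    proof (intro exI[of _ "insert s P"] exI[of _ "u(s := v')"] conjI ballI impI)
      show "insert s P \<subseteq> insert s S"
        using P by blast
      show "(u(s := v')) p \<in> W" if "p \<in> insert s P" for p
        using that v'W uW by auto
      show "(u(s := v')) p q = (if p = q then 1 else 0)"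
        if "p \<in> insert s P" "q \<in> insert s P" for p q
        using that snP by (auto simp: v's v'P us dual)
      show "a = 0" if "a \<in> W" "\<forall>p\<in>insert s P. a p = 0" for a
        using that by (intro sep) (auto simp: W'_def)
    qed
  qed
qed

text \<open>
  With respect to a nondegenerate diagonal bilinear form, a vector \<open>a\<close> is orthogonal to the echelon
  basis \<open>u\<close> of \<open>W\<close> precisely when its entry at each pivot is a prescribed combination of its entries
  off the pivots.  The latter are therefore free coordinates on the annihilator, and the vectors
  \<open>n q\<close> are the dual family.
\<close>

lemma dim_annihilator:
  fixes W :: "('a::finite \<Rightarrow> complex) set"
  assumes W: "coord.subspace W" and supp: "\<And>a i. a \<in> W \<Longrightarrow> a i \<noteq> 0 \<Longrightarrow> i \<in> S"
    and c: "\<And>i. c i \<noteq> 0"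
  shows "coord.dim W +
    coord.dim {a. (\<forall>i. a i \<noteq> 0 \<longrightarrow> i \<in> S) \<and> (\<forall>v\<in>W. (\<Sum>i\<in>UNIV. c i * a i * v i) = 0)} = card S"
    (is "_ + coord.dim ?N = _")
proof -
  have ex: "\<exists>P u. P \<subseteq> S \<and> (\<forall>p\<in>P. u p \<in> W) \<and> (\<forall>p\<in>P. \<forall>q\<in>P. u p q = (if p = q then 1 else 0)) \<and>
      (\<forall>a\<in>W. (\<forall>p\<in>P. a p = 0) \<longrightarrow> a = 0)"
    by (rule pivots_exist[OF W finite]) (rule supp)
  obtain P u where P: "P \<subseteq> S" and "\<forall>p\<in>P. u p \<in> W"
      and "\<forall>p\<in>P. \<forall>q\<in>P. u p q = (if p = q then 1 else 0)"
      and sep': "\<forall>a\<in>W. (\<forall>p\<in>P. a p = 0) \<longrightarrow> a = 0"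
    using ex by - (elim exE conjE, rule that)
  then have uW: "u p \<in> W" and dual: "q \<in> P \<Longrightarrow> u p q = (if p = q then 1 else 0)" if "p \<in> P" for p q
    using that by blast+
  have sep: "a = 0" if "a \<in> W" "\<And>p. p \<in> P \<Longrightarrow> a p = 0" for a
    using that sep' by blast
  have dimW: "coord.dim W = card P"
    by (rule coord.dim_eq_card_dual_family[OF W finite, where u = u and \<chi> = "\<lambda>p a. a p"])
       (simp_all add: uW dual sep)
  define n where "n = (\<lambda>q i. if i \<in> P then - c q * u i q / c i else if i = q then 1 else 0)"
  have pair_u: "(\<Sum>i\<in>UNIV. c i * a i * u p i) = c p * a p + (\<Sum>i\<in>S-P. c i * a i * u p i)"
    if "p \<in> P" for p and a :: "'a \<Rightarrow> complex"
  proof -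
    have "(\<Sum>i\<in>UNIV. c i * a i * u p i) = (\<Sum>i\<in>S. c i * a i * u p i)"
      using supp[OF uW[OF that]] by (intro sum.mono_neutral_right) auto
    also have "\<dots> = (\<Sum>i\<in>P. c i * a i * u p i) + (\<Sum>i\<in>S-P. c i * a i * u p i)"
      by (subst sum.subset_diff[OF P finite]) (rule add.commute)
    also have "(\<Sum>i\<in>P. c i * a i * u p i) = (\<Sum>i\<in>P. c i * a i * (if p = i then 1 else 0))"
      using that by (intro sum.cong) (auto simp: dual)
    also have "\<dots> = c p * a p"
      using that by (simp add: if_distrib cong: if_cong)
    finally show ?thesis .
  qed
  have n_in: "n q \<in> ?N" if q: "q \<in> S - P" for q
  proof (safe)
    show "i \<in> S" if "n q i \<noteq> 0" for i
      using that q P by (auto simp: n_def split: if_splits)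
    fix v assume v: "v \<in> W"
    have pu: "(\<Sum>i\<in>UNIV. c i * n q i * u p i) = 0" if p: "p \<in> P" for p
    proof -
      have "(\<Sum>i\<in>S-P. c i * n q i * u p i) = (\<Sum>i\<in>S-P. if i = q then c q * u p q else 0)"
        by (intro sum.cong) (auto simp: n_def)
      also have "\<dots> = c q * u p q"
        using q by simp
      finally show ?thesis
        unfolding pair_u[OF p] using p c[of p] by (simp add: n_def)
    qed
    have v_eq: "v = (\<Sum>p\<in>P. (\<lambda>i. v p * u p i))"
      by (rule coord.dual_family_expansion[OF W finite, where \<chi> = "\<lambda>p a. a p"])
         (simp_all add: uW dual sep v)
    have v_at: "v i = (\<Sum>p\<in>P. v p * u p i)" for i
      by (subst v_eq) (simp add: sum_fun_apply)
    have "(\<Sum>i\<in>UNIV. c i * n q i * v i) = (\<Sum>i\<in>UNIV. \<Sum>p\<in>P. v p * (c i * n q i * u p i))"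
      by (intro sum.cong refl, subst v_at) (simp add: sum_distrib_left mult_ac)
    also have "\<dots> = (\<Sum>p\<in>P. v p * (\<Sum>i\<in>UNIV. c i * n q i * u p i))"
      by (subst sum.swap) (simp add: sum_distrib_left)
    also have "\<dots> = 0"
      by (simp add: pu)
    finally show "(\<Sum>i\<in>UNIV. c i * n q i * v i) = 0" .
  qed
  have dimN: "coord.dim ?N = card (S - P)"
  proof (rule coord.dim_eq_card_dual_family[where u = n and \<chi> = "\<lambda>p a. a p"])
    show "coord.subspace ?N"
    proof (rule coord.subspaceI)
      show "0 \<in> ?N" by simp
    next
      fix x y assume x: "x \<in> ?N" and y: "y \<in> ?N"
      have "(x + y) i \<noteq> 0 \<longrightarrow> i \<in> S" for i
        using x y by (cases "x i = 0") auto
      moreover have "(\<Sum>i\<in>UNIV. c i * (x + y) i * v i) =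
          (\<Sum>i\<in>UNIV. c i * x i * v i) + (\<Sum>i\<in>UNIV. c i * y i * v i)" for v
        by (simp add: algebra_simps sum.distrib)
      ultimately show "x + y \<in> ?N"
        using x y by simp
    next
      fix k :: complex and x assume x: "x \<in> ?N"
      have "(\<Sum>i\<in>UNIV. c i * (k * x i) * v i) = k * (\<Sum>i\<in>UNIV. c i * x i * v i)" for v
        by (simp add: sum_distrib_left mult_ac)
      then show "(\<lambda>i. k * x i) \<in> ?N"
        using x by auto
    qed
    show "a = 0" if a: "a \<in> ?N" and z: "\<And>q. q \<in> S - P \<Longrightarrow> a q = 0" for a
    proof
      fix i
      have "a i = 0" if i: "i \<in> P"
        using a uW[OF i] pair_u[OF i, of a] z c[of i] by auto
      then show "a i = 0 i"
        using a z[of i] by auto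
    qed
  qed (use n_in in \<open>auto simp: n_def\<close>)
  have "card P + card (S - P) = card S"
    using P by (simp add: card_Diff_subset finite_subset card_mono)
  then show ?thesis
    by (simp add: dimW dimN)
qed

lemma dim_supported:
  fixes Q :: "'a::finite \<Rightarrow> bool"
  shows "coord.dim {a. \<forall>i. a i \<noteq> 0 \<longrightarrow> Q i} = card {i. Q i}"
proof -
  have "coord.subspace {0::'a \<Rightarrow> complex}"
    by (rule coord.subspace_single_0)
  moreover have "coord.dim {0::'a \<Rightarrow> complex} = 0"
    by (rule coord.dim_unique[of "{}"]) (auto simp: coord.independent_empty coord.span_empty)
  ultimately show ?thesis
    using dim_annihilator[of "{0}" "{i. Q i}" "\<lambda>_. 1"] by simp
qed

section \<open>Numerical consequences of graded Gorenstein duality\<close>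

lemma dim_single_0: "coord.dim {0::'a \<Rightarrow> complex} = 0"
  by (rule coord.dim_unique[of "{}"]) (auto simp: coord.independent_empty)

lemma subspace_constant_on: "coord.subspace (range (\<lambda>x i. if i \<in> Q then x else 0))"
  (is "coord.subspace ?C")
proof (rule coord.subspaceI)
  show "0 \<in> ?C"
    by (auto simp: fun_eq_iff intro!: image_eqI[of _ _ 0])
next
  fix x y assume "x \<in> ?C" "y \<in> ?C"
  then obtain r t where "x = (\<lambda>i. if i \<in> Q then r else 0)" "y = (\<lambda>i. if i \<in> Q then t else 0)"
    by blast
  then show "x + y \<in> ?C"
    by (auto simp: fun_eq_iff intro!: image_eqI[of _ _ "r + t"])
next
  fix k :: complex and x assume "x \<in> ?C"
  then obtain r where "x = (\<lambda>i. if i \<in> Q then r else 0)"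
    by blast
  then show "(\<lambda>i. k * x i) \<in> ?C"
    by (auto simp: fun_eq_iff intro!: image_eqI[of _ _ "k * r"])
qed

lemma dim_constant_on:
  "coord.dim (range (\<lambda>x i. if i \<in> Q then x else 0)) = (if Q = {} then 0 else 1)"
  (is "coord.dim ?C = _")
proof (cases "Q = {}")
  case True
  then have "?C = {0}"
    by (auto simp: fun_eq_iff)
  then show ?thesis
    using True dim_single_0 by simp
next
  case False
  then obtain s where s: "s \<in> Q" by blast
  have "coord.dim ?C = card {s}"
    by (rule coord.dim_eq_card_dual_family[OF subspace_constant_on,
          where u = "\<lambda>_ i. if i \<in> Q then 1 else 0" and \<chi> = "\<lambda>p a. a p"])
       (use s in \<open>auto simp: fun_eq_iff\<close>)
  then show ?thesis
    using False by simp
qed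

text \<open>
  The hyperplane is the annihilator of the constant vectors on \<open>Q\<close>.  The truncated subtraction
  gives the right value \<open>0\<close> for empty \<open>Q\<close>.
\<close>

lemma dim_hyperplane:
  fixes Q :: "'a::finite set"
  assumes "\<And>i. c i \<noteq> 0"
  shows "coord.dim {a. (\<forall>i. a i \<noteq> 0 \<longrightarrow> i \<in> Q) \<and> (\<Sum>i\<in>UNIV. c i * a i) = 0} = card Q - 1"
    (is "coord.dim ?H = _")
proof -
  let ?C = "range (\<lambda>x i. if i \<in> Q then x else 0)"
  have "(\<Sum>i\<in>UNIV. c i * a i * (if i \<in> Q then x else 0)) = (\<Sum>i\<in>UNIV. c i * a i) * x"
    if "\<forall>i. a i \<noteq> 0 \<longrightarrow> i \<in> Q" for a x
    unfolding sum_distrib_right using that by (intro sum.cong) auto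
  then have eqv: "(\<forall>v\<in>?C. (\<Sum>i\<in>UNIV. c i * a i * v i) = 0) \<longleftrightarrow> (\<Sum>i\<in>UNIV. c i * a i) = 0"
    if "\<forall>i. a i \<noteq> 0 \<longrightarrow> i \<in> Q" for a
    using that by (auto dest: spec[of _ 1])
  have "?H = {a. (\<forall>i. a i \<noteq> 0 \<longrightarrow> i \<in> Q) \<and> (\<forall>v\<in>?C. (\<Sum>i\<in>UNIV. c i * a i * v i) = 0)}"
    by (intro Collect_cong conj_cong refl) (simp only: eqv)
  moreover have "coord.dim ?C + coord.dim \<dots> = card Q"
    by (rule dim_annihilator[OF subspace_constant_on _ assms]) (auto split: if_splits)
  ultimately show ?thesis
    by (auto simp: dim_constant_on split: if_splits)
qed

text \<open>
  Let \<open>A j\<close> be the space of leading coefficients of the homogeneous functions of degree \<open>j\<close>.  A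
  differential of order \<open>m\<close> and weight \<open>k\<close> is a homogeneous function of degree \<open>m l - k\<close> times the
  \<open>m\<close>-th power of the homogeneous generator, which has weight \<open>l\<close>.  A pole of order at most \<open>p\<close> at
  the points at infinity amounts to \<open>(m - p) b i \<le> k\<close> on every branch \<open>i\<close> where the differential
  does not vanish.  So \<open>q = m\<close> gives regular and \<open>q = 0\<close> gives logarithmic differentials.
\<close>

definition bounded_pole_dim ::
    "('a \<Rightarrow> int) \<Rightarrow> int \<Rightarrow> (int \<Rightarrow> ('a \<Rightarrow> complex) set) \<Rightarrow> int \<Rightarrow> int \<Rightarrow> int \<Rightarrow> nat" where
  "bounded_pole_dim b l A m q k = coord.dim {a \<in> A (m * l - k). \<forall>i. a i \<noteq> 0 \<longrightarrow> q * b i \<le> k}"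

text \<open>
  The part of the structure that determines the weights: \<open>b i\<close> is minus the weight of \<open>t\<^sub>i\<close>, \<open>l\<close> is
  the weight of the homogeneous generator of the dualizing module and \<open>c i\<close> its coefficient on the
  branch \<open>i\<close>.  In degree \<open>0\<close> there are only the constants because all branches pass through one
  point.  The last condition is the Gorenstein property: \<open>A j\<close> and \<open>A (l - j)\<close> are annihilators of
  each other under the residue pairing.
\<close>

locale graded_duality =
  fixes b :: "'a::finite \<Rightarrow> int" and l :: int and c :: "'a \<Rightarrow> complex"
    and A :: "int \<Rightarrow> ('a \<Rightarrow> complex) set"
  assumes l_pos: "l > 0" and b_pos: "b i > 0" and b_dvd: "b i dvd l" and c_nz: "c i \<noteq> 0"
    and A_supp: "a \<in> A j \<Longrightarrow> a i \<noteq> 0 \<Longrightarrow> b i dvd j"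
    and A_sub: "coord.subspace (A j)"
    and A_neg: "j < 0 \<Longrightarrow> A j \<subseteq> {0}"
    and A_0: "A 0 = range (\<lambda>x i. x)"
    and A_dual: "A (l - j) =
      {a. (\<forall>i. a i \<noteq> 0 \<longrightarrow> b i dvd j) \<and> (\<forall>v\<in>A j. (\<Sum>i\<in>UNIV. c i * a i * v i) = 0)}"
begin

text \<open>
  Duality between the degrees \<open>j\<close> and \<open>l - j\<close>; the right-hand side is the dimension of the degree
  \<open>j\<close> part of the normalization (or of its ring of fractions).
\<close>

lemma dim_dual: "coord.dim (A j) + coord.dim (A (l - j)) = card {i. b i dvd j}"
proof -
  have "a i \<noteq> 0 \<Longrightarrow> i \<in> {i. b i dvd j}" if "a \<in> A j" for a i
    using A_supp[OF that] by simp
  from dim_annihilator[of "A j" "{i. b i dvd j}" c, OF A_sub this c_nz] show ?thesis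
    by (simp add: A_dual)
qed

lemma A_neg_eq: "j < 0 \<Longrightarrow> A j = {0}"
  using A_neg[of j] coord.subspace_0[OF A_sub[of j]] by blast

text \<open>
  Beyond the degree \<open>l\<close> the dual degree is negative, so there is no condition left and every
  homogeneous function on the normalization belongs to the singularity.
\<close>

lemma A_large: "l < j \<Longrightarrow> A j = {a. \<forall>i. a i \<noteq> 0 \<longrightarrow> b i dvd j}"
proof -
  assume "l < j"
  moreover have "b i dvd l - j \<longleftrightarrow> b i dvd j" for i
    using dvd_diff_right_iff[OF b_dvd[of i], of j] by (simp add: dvd_diff_commute)
  ultimately show ?thesis
    using A_dual[of "l - j"] A_neg_eq[of "l - j"] by simp
qed

lemma dim_A_0: "coord.dim (A 0) = 1"
proof -
  have "A 0 = range (\<lambda>x i. if i \<in> UNIV then x else 0)"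
    by (simp add: A_0)
  then show ?thesis
    by (simp only: dim_constant_on) simp
qed

lemma bounded_pole_dim_neg: "m * l < k \<Longrightarrow> bounded_pole_dim b l A m q k = 0"
proof -
  assume "m * l < k"
  then have "A (m * l - k) = {0}"
    by (intro A_neg_eq) simp
  then have "{a \<in> A (m * l - k). \<forall>i. a i \<noteq> 0 \<longrightarrow> q * b i \<le> k} = {0}"
    by auto
  then show ?thesis
    by (simp only: bounded_pole_dim_def dim_single_0)
qed

text \<open>
  In the degrees \<open>j < l\<close> the condition at infinity is automatic: a branch on which a function of
  degree \<open>j\<close> does not vanish has \<open>b i\<close> dividing \<open>l - j > 0\<close>, whence \<open>m b i \<le> m (l - j) \<le> m l - j\<close>.
\<close>

lemma regular_dim_low:
  assumes m: "m \<ge> 1" and j: "0 \<le> j" "j < l"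
  shows "bounded_pole_dim b l A m m (m * l - j) = coord.dim (A j)"
proof -
  have "m * b i \<le> m * l - j" if a: "a \<in> A j" "a i \<noteq> 0" for a i
  proof -
    have "b i dvd l - j"
      using A_supp[OF a] b_dvd[of i] by simp
    then have "b i \<le> l - j"
      using j by (intro zdvd_imp_le) auto
    then have "m * b i \<le> m * (l - j)"
      using m by (intro mult_left_mono) auto
    also have "\<dots> \<le> m * l - j"
      using m j mult_right_mono[of 1 m j] by (simp add: algebra_simps)
    finally show ?thesis .
  qed
  then have "{a \<in> A j. \<forall>i. a i \<noteq> 0 \<longrightarrow> m * b i \<le> m * l - j} = A j"
    by blast
  then show ?thesis
    by (simp add: bounded_pole_dim_def)
qed

text \<open>
  In the degree \<open>l\<close> the functions are the vectors orthogonal to the constants, and for \<open>m \<ge> 2\<close> the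
  condition at infinity says that they vanish on the branches with \<open>b i = l\<close>.
\<close>

lemma regular_dim_top:
  assumes m: "m \<ge> 2"
  shows "bounded_pole_dim b l A m m (m * l - l) = card {i. b i < l} - 1"
proof -
  define Q where "Q = {i. b i < l}"
  have Q_iff: "m * b i \<le> m * l - l \<longleftrightarrow> i \<in> Q" for i
  proof
    assume "m * b i \<le> m * l - l"
    then have "m * b i < m * l"
      using l_pos by linarith
    then show "i \<in> Q"
      using m by (simp add: Q_def)
  next
    assume "i \<in> Q"
    then have lt: "b i < l" by (simp add: Q_def)
    \<comment> \<open>a proper divisor of \<open>l\<close> is at most half of \<open>l\<close>\<close>
    obtain e where e: "l = b i * e"
      using b_dvd[of i] by (elim dvdE)
    have "e > 1"
      using lt e b_pos[of i] l_pos by (cases "e \<le> 1") (auto simp: mult_le_cancel_left1 not_le zero_less_mult_iff)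
    then have "b i * 2 \<le> l"
      unfolding e using b_pos[of i] by (intro mult_left_mono) auto
    then have "b i \<le> l - b i" "l \<le> 2 * (l - b i)" by auto
    moreover have "2 * (l - b i) \<le> m * (l - b i)"
      using m lt by (intro mult_right_mono) auto
    ultimately show "m * b i \<le> m * l - l"
      by (simp add: algebra_simps)
  qed
  have "A l = {a. (\<Sum>i\<in>UNIV. c i * a i) = 0}"
  proof -
    have "A l = {a. \<forall>x. (\<Sum>i\<in>UNIV. c i * a i * x) = 0}"
      using A_dual[of 0] by (simp add: A_0)
    also have "\<dots> = {a. (\<Sum>i\<in>UNIV. c i * a i) = 0}"
    proof -
      have "(\<Sum>i\<in>UNIV. c i * a i * x) = (\<Sum>i\<in>UNIV. c i * a i) * x" for a x
        by (simp add: sum_distrib_right)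
      then show ?thesis by auto
    qed
    finally show ?thesis .
  qed
  then have "{a \<in> A l. \<forall>i. a i \<noteq> 0 \<longrightarrow> m * b i \<le> m * l - l} =
      {a. (\<forall>i. a i \<noteq> 0 \<longrightarrow> i \<in> Q) \<and> (\<Sum>i\<in>UNIV. c i * a i) = 0}"
    by (auto simp: Q_iff)
  then show ?thesis
    using dim_hyperplane[of c Q, OF c_nz] by (simp add: bounded_pole_dim_def Q_def)
qed

lemma regular_dim_high:
  assumes j: "l < j"
  shows "bounded_pole_dim b l A m m (m * l - j) = card {i. b i dvd j \<and> m * b i \<le> m * l - j}"
proof -
  have "{a \<in> A j. \<forall>i. a i \<noteq> 0 \<longrightarrow> m * b i \<le> m * l - j} =
      {a. \<forall>i. a i \<noteq> 0 \<longrightarrow> b i dvd j \<and> m * b i \<le> m * l - j}"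
    using A_large[OF j] by auto
  then show ?thesis
    using dim_supported by (simp add: bounded_pole_dim_def)
qed

lemma log_dim:
  "bounded_pole_dim b l A m 0 k = (if 0 \<le> k then coord.dim (A (m * l - k)) else 0)"
proof (cases "0 \<le> k")
  case False
  then have "{a \<in> A (m * l - k). \<forall>i. a i \<noteq> 0 \<longrightarrow> 0 * b i \<le> k} = {0}"
    using coord.subspace_0[OF A_sub[of "m * l - k"]] by (auto simp: fun_eq_iff)
  then show ?thesis
    using False by (simp only: bounded_pole_dim_def dim_single_0 if_False)
qed (simp add: bounded_pole_dim_def)

lemma card_dvd_mod: "card {i. b i dvd j} = card {i. b i dvd j mod l}"
  using b_dvd by (simp add: dvd_mod_iff)

text \<open>
  Since every \<open>b i\<close> divides \<open>l\<close>, the dimensions of the graded pieces of the normalization are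
  periodic of period \<open>l\<close>, and duality expresses them by degrees between \<open>0\<close> and \<open>l\<close>.
\<close>

lemma dim_A_high:
  assumes "l < j"
  shows "coord.dim (A j) = coord.dim (A (j mod l)) + coord.dim (A (l - j mod l))"
proof -
  have "coord.dim (A j) = card {i. b i dvd j}"
    unfolding A_large[OF assms] by (rule dim_supported)
  then show ?thesis
    by (simp only: dim_dual card_dvd_mod[of j])
qed

end

lemma card_by_values:
  fixes b :: "'a::finite \<Rightarrow> int"
  assumes "\<And>i. Q (b i) \<Longrightarrow> b i \<in> D" and "finite D"
  shows "card {i. Q (b i)} = (\<Sum>d\<in>{d\<in>D. Q d}. card {i. b i = d})"
proof -
  have "card {i. Q (b i)} = (\<Sum>i\<in>{i. Q (b i)}. 1)"
    by simp
  also have "\<dots> = (\<Sum>d\<in>{d\<in>D. Q d}. \<Sum>i\<in>{i\<in>{i. Q (b i)}. b i = d}. 1)"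
    using assms by (intro sum.group[symmetric]) auto
  also have "\<dots> = (\<Sum>d\<in>{d\<in>D. Q d}. card {i. b i = d})"
    by (intro sum.cong refl) (auto intro!: arg_cong[where f = card])
  finally show ?thesis .
qed

text \<open>
  Moebius inversion over divisors: the number of branches with \<open>b i\<close> dividing \<open>j\<close> is the sum over
  the divisors \<open>d\<close> of \<open>j\<close> of the number of branches with \<open>b i = d\<close>.
\<close>

lemma card_eq_from_card_dvd:
  fixes b :: "'a::finite \<Rightarrow> int" and b' :: "'b::finite \<Rightarrow> int"
  assumes pos: "\<And>i. b i > 0" "\<And>i. b' i > 0"
    and eq: "\<And>j. 0 < j \<Longrightarrow> j < l \<Longrightarrow> card {i. b i dvd j} = card {i. b' i dvd j}"
  shows "0 < d \<Longrightarrow> d < l \<Longrightarrow> card {i. b i = d} = card {i. b' i = d}"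
proof (induction "nat d" arbitrary: d rule: less_induct)
  case less
  have split: "card {i. g i dvd d} = card {i. g i = d} + (\<Sum>e\<in>{e\<in>{1..<d}. e dvd d}. card {i. g i = e})"
    if "\<And>i. g i > 0" for g :: "'c::finite \<Rightarrow> int"
  proof -
    have "1 \<le> g i \<and> g i \<le> d" if "g i dvd d" for i
      using that \<open>\<And>i. g i > 0\<close>[of i] less.prems by (auto intro: zdvd_imp_le)
    then have "card {i. g i dvd d} = (\<Sum>e\<in>{e\<in>{1..d}. e dvd d}. card {i. g i = e})"
      by (intro card_by_values) auto
    also have "{e\<in>{1..d}. e dvd d} = insert d {e\<in>{1..<d}. e dvd d}"
      using less.prems by auto
    moreover have "finite {e\<in>{1..<d}. e dvd d}"
      by (rule finite_subset[of _ "{1..<d}"]) auto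
    ultimately show ?thesis
      by simp
  qed
  have "(\<Sum>e\<in>{e\<in>{1..<d}. e dvd d}. card {i. b i = e}) = (\<Sum>e\<in>{e\<in>{1..<d}. e dvd d}. card {i. b' i = e})"
    using less.prems by (intro sum.cong refl less.hyps) auto
  then show ?case
    using eq[OF less.prems] split[of b] split[of b'] pos by simp
qed

text \<open>
  The weight \<open>l\<close> is the largest weight of a one-form: it belongs to the homogeneous generator, and
  larger weights would need functions of negative degree.
\<close>

lemma same_length:
  assumes X: "graded_duality b l c A" and Y: "graded_duality b' l' c' A'"
    and q: "q = 0 \<or> q = 1"
    and eq: "\<And>k. bounded_pole_dim b l A 1 q k = bounded_pole_dim b' l' A' 1 q k"
  shows "l' \<le> l"
proof (rule ccontr)
  interpret X: graded_duality b l c A by fact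
  interpret Y: graded_duality b' l' c' A' by fact
  assume "\<not> l' \<le> l"
  then have "bounded_pole_dim b l A 1 q l' = 0"
    by (intro X.bounded_pole_dim_neg) simp
  moreover have "bounded_pole_dim b' l' A' 1 q l' = 1"
    using q Y.regular_dim_low[of 1 0] Y.log_dim[of 1 l'] Y.dim_A_0 Y.l_pos by auto
  ultimately show False
    using eq by simp
qed

text \<open>
  The regular one-forms give \<open>l\<close> and the dimensions in the degrees \<open>j < l\<close>, hence by duality the
  number of branches with \<open>b i\<close> dividing \<open>j\<close> for \<open>0 < j < l\<close>, and so the number of branches with any
  given \<open>b i < l\<close>.  The number of branches with \<open>b i = l\<close> remains unknown, but no differential that is
  regular at infinity sees these branches in a positive degree.
\<close>

lemma regular_dims_determined:
  assumes X: "graded_duality b l c A" and Y: "graded_duality b' l' c' A'"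
    and eq: "\<And>k. bounded_pole_dim b l A 1 1 k = bounded_pole_dim b' l' A' 1 1 k"
    and m: "m \<ge> 2"
  shows "bounded_pole_dim b l A m m k = bounded_pole_dim b' l' A' m m k"
proof -
  interpret X: graded_duality b l c A by fact
  interpret Y: graded_duality b' l' c' A' by fact
  have l': "l' = l"
    using same_length[OF X Y _ eq] same_length[OF Y X _ eq[symmetric]] by simp
  have low: "coord.dim (A j) = coord.dim (A' j)" if "0 \<le> j" "j < l" for j
    using X.regular_dim_low[of 1 j] Y.regular_dim_low[of 1 j] that eq l' by simp
  have dvd_eq: "card {i. b i dvd j} = card {i. b' i dvd j}" if "0 < j" "j < l" for j
    unfolding X.dim_dual[symmetric] Y.dim_dual[symmetric] l' using low that by simp
  have val: "card {i. b i = d} = card {i. b' i = d}" if "0 < d" "d < l" for d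
    using card_eq_from_card_dvd[OF X.b_pos Y.b_pos dvd_eq that] .
  have sub: "card {i. Q (b i)} = card {i. Q (b' i)}" if "\<And>d. Q d \<Longrightarrow> d < l" for Q
  proof -
    have "card {i. Q (b i)} = (\<Sum>d\<in>{d\<in>{1..<l}. Q d}. card {i. b i = d})"
      using X.b_pos that by (intro card_by_values) (auto simp: int_one_le_iff_zero_less)
    also have "\<dots> = (\<Sum>d\<in>{d\<in>{1..<l}. Q d}. card {i. b' i = d})"
      by (intro sum.cong refl val) auto
    also have "\<dots> = card {i. Q (b' i)}"
      using Y.b_pos that by (intro card_by_values[symmetric]) (auto simp: int_one_le_iff_zero_less)
    finally show ?thesis .
  qed
  define j where "j = m * l - k"
  have k: "k = m * l - j"
    by (simp add: j_def)
  have m1: "m \<ge> 1" using m by simp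
  consider "j < 0" | "0 \<le> j" "j < l" | "j = l" | "j > l" by linarith
  then show ?thesis
  proof cases
    case 1
    then show ?thesis
      using X.bounded_pole_dim_neg[of m k] Y.bounded_pole_dim_neg[of m k] k l' by simp
  next
    case 2
    then show ?thesis
      using X.regular_dim_low[OF m1 2] Y.regular_dim_low[OF m1, of j] low k l' by simp
  next
    case 3
    then show ?thesis
      using X.regular_dim_top[OF m] Y.regular_dim_top[OF m] sub[of "\<lambda>d. d < l"] k l' by simp
  next
    case 4
    have "d < l" if "d dvd j \<and> m * d \<le> m * l - j" for d
    proof -
      have "m * d < m * l"
        using that 4 X.l_pos by linarith
      then show ?thesis
        using m by simp
    qed
    then show ?thesis
      using X.regular_dim_high[OF 4, of m] Y.regular_dim_high[of j m] 4 k l'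
        sub[of "\<lambda>d. d dvd j \<and> m * d \<le> m * l - j"] by simp
  qed
qed

text \<open>
  The logarithmic one-forms give \<open>l\<close> and the dimensions in the degrees \<open>j \<le> l\<close>, which determine
  those in all other degrees.
\<close>

lemma log_dims_determined:
  assumes X: "graded_duality b l c A" and Y: "graded_duality b' l' c' A'"
    and eq: "\<And>k. bounded_pole_dim b l A 1 0 k = bounded_pole_dim b' l' A' 1 0 k"
  shows "bounded_pole_dim b l A m 0 k = bounded_pole_dim b' l' A' m 0 k"
proof -
  interpret X: graded_duality b l c A by fact
  interpret Y: graded_duality b' l' c' A' by fact
  have l': "l' = l"
    using same_length[OF X Y _ eq] same_length[OF Y X _ eq[symmetric]] by simp
  have low: "coord.dim (A j) = coord.dim (A' j)" if "j \<le> l" for j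
    using X.log_dim[of 1 "l - j"] Y.log_dim[of 1 "l - j"] that eq l' by simp
  have "coord.dim (A j) = coord.dim (A' j)" for j
  proof (cases "j \<le> l")
    case False
    have "j mod l \<le> l" "l - j mod l \<le> l"
      using pos_mod_bound[OF X.l_pos, of j] pos_mod_sign[OF X.l_pos, of j] by auto
    then show ?thesis
      using False X.dim_A_high[of j] Y.dim_A_high[of j] low l' by simp
  qed (rule low)
  then show ?thesis
    using Y.log_dim[of m k] l' by (simp add: X.log_dim)
qed

section \<open>Homogeneous germs and weight spaces\<close>

definition monomial_germ :: "('b \<Rightarrow> int) \<Rightarrow> ('b \<Rightarrow> complex) \<Rightarrow> 'b germ" where
  "monomial_germ e a = (\<lambda>i. fls_shift (- e i) (fls_const (a i)))"

lemma monomial_germ_nth: "monomial_germ e a i $$ k = (if k = e i then a i else 0)"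
  by (auto simp: monomial_germ_def)

lemma monomial_germ_mult:
  "monomial_germ e a * monomial_germ e' a' = monomial_germ (\<lambda>i. e i + e' i) (\<lambda>i. a i * a' i)"
  by (auto simp: fun_eq_iff monomial_germ_def fls_shifted_times_simps algebra_simps)

lemma monomial_germ_power:
  "monomial_germ e a ^ m = monomial_germ (\<lambda>i. int m * e i) (\<lambda>i. a i ^ m)"
proof (induction m)
  case 0
  show ?case by (auto simp: fun_eq_iff monomial_germ_def)
next
  case (Suc m)
  then show ?case by (simp add: monomial_germ_mult algebra_simps)
qed

lemma residue_times_monomial_germ:
  "fls_residue (f * monomial_germ e a i) = a i * f $$ (- 1 - e i)"
  by (simp add: monomial_germ_def fls_shifted_times_simps mult.commute[of f])

lemma monomial_germ_times_nth:
  "(f * monomial_germ e a i) $$ k = a i * f $$ (k - e i)"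
  by (simp add: monomial_germ_def fls_shifted_times_simps mult.commute[of f])

lemma monomial_germ_cancel:
  assumes "f * monomial_germ e a = g * monomial_germ e a" and nz: "\<And>i. a i \<noteq> 0"
  shows "f = g"
proof (intro ext fls_eqI)
  fix i k
  have "(f * monomial_germ e a) i $$ (k + e i) = (g * monomial_germ e a) i $$ (k + e i)"
    by (simp only: assms(1))
  then show "f i $$ k = g i $$ k"
    using nz[of i] by (simp add: monomial_germ_times_nth)
qed

text \<open>
  The coefficients of a product as a sum over a range that does not depend on the orders of the
  factors, so that one range serves for all functions of a singularity at once.
\<close>

lemma fls_mult_nth_of_bounds:
  fixes f g :: "complex fls"
  assumes f: "\<And>k. k < 0 \<Longrightarrow> f $$ k = 0" and g: "\<And>k. k < n - int N \<Longrightarrow> g $$ k = 0"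
  shows "(f * g) $$ n = (\<Sum>k\<le>N. f $$ int k * g $$ (n - int k))"
proof (cases "f = 0 \<or> g = 0")
  case True
  then show ?thesis by auto
next
  case False
  then have "fls_subdegree f \<ge> 0" "fls_subdegree g \<ge> n - int N"
    using f g by (auto intro: fls_subdegree_geI)
  then have "(\<Sum>i=fls_subdegree f..n - fls_subdegree g. f $$ i * g $$ (n - i)) =
      (\<Sum>i=0..int N. f $$ i * g $$ (n - i))"
    by (intro sum.mono_neutral_left) auto
  also have "\<dots> = (\<Sum>k\<le>N. f $$ int k * g $$ (n - int k))"
    by (rule sum.reindex_bij_witness[of _ int nat]) auto
  finally show ?thesis
    by (simp add: fls_times_nth(2))
qed

lemma fls_rescale_nth: "c \<noteq> 0 \<Longrightarrow> fls_rescale c f $$ k = c powi k * f $$ k"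
  unfolding fls_rescale_def
  by (rule nth_Abs_fls_ex_lower_bound) (auto intro!: exI[of _ "fls_subdegree f"])

lemma Gm_act_nth:
  assumes "z \<noteq> 0"
  shows "Gm_act w m z h i $$ k = z powi (w i * (k + int m)) * h i $$ k"
proof -
  have "z powi (w i * (k + int m)) = (z powi w i) powi k * (z powi w i) ^ m"
    using assms by (simp add: power_int_mult power_int_add)
  then show ?thesis
    using assms by (simp add: Gm_act_def fls_rescale_nth)
qed

lemma weight_space_iff:
  "h \<in> weight_space w m V k \<longleftrightarrow> h \<in> V \<and> (\<forall>i s. h i $$ s \<noteq> 0 \<longrightarrow> w i * (s + int m) = k)"
proof -
  \<comment> \<open>one scalar that is not a root of unity suffices to separate the weights\<close>
  have inj: "x = y" if "(2::complex) powi x = 2 powi y" for x y :: int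
  proof -
    have "(2::real) powi x = 2 powi y"
      using arg_cong[OF that, of norm] by (simp add: norm_power_int)
    then show ?thesis
      using power_int_strict_increasing[of x y "2::real"] power_int_strict_increasing[of y x "2::real"]
      by (cases x y rule: linorder_cases) auto
  qed
  have act: "Gm_act w m z h = const_germ (z powi k) * h \<longleftrightarrow>
      (\<forall>i s. h i $$ s \<noteq> 0 \<longrightarrow> z powi (w i * (s + int m)) = z powi k)" if "z \<noteq> 0" for z
    using that by (auto simp: fun_eq_iff fls_eq_iff Gm_act_nth const_germ_def)
  show ?thesis
  proof
    assume h: "h \<in> weight_space w m V k"
    then have "Gm_act w m 2 h = const_germ (2 powi k) * h"
      by (simp add: weight_space_def)
    then show "h \<in> V \<and> (\<forall>i s. h i $$ s \<noteq> 0 \<longrightarrow> w i * (s + int m) = k)"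
      using h inj by (auto simp: act weight_space_def)
  qed (auto simp: weight_space_def act)
qed

text \<open>
  On homogeneous elements the exponents are fixed branch by branch, and the coefficients are
  coordinates.
\<close>

lemma dim_monomial_image:
  fixes B :: "('b::finite \<Rightarrow> complex) set"
  assumes B: "coord.subspace B" and d: "\<And>i. d i \<noteq> 0"
  shows "vector_space.dim (\<lambda>c h. const_germ c * h) ((\<lambda>a. monomial_germ e (\<lambda>i. a i * d i)) ` B) =
    coord.dim B" (is "_ (?F ` B) = _")
proof -
  interpret germ: vector_space "\<lambda>c h. const_germ c * h :: 'b germ"
    by unfold_locales
      (auto simp: const_germ_def fun_eq_iff algebra_simps simp flip: fls_plus_const)
  have ex: "\<exists>P u. P \<subseteq> UNIV \<and> (\<forall>p\<in>P. u p \<in> B) \<and> (\<forall>p\<in>P. \<forall>q\<in>P. u p q = (if p = q then 1 else 0)) \<and>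
      (\<forall>a\<in>B. (\<forall>p\<in>P. a p = 0) \<longrightarrow> a = 0)"
    by (rule pivots_exist[OF B finite]) simp
  obtain P u where uB: "\<forall>p\<in>P. u p \<in> B"
      and dual: "\<forall>p\<in>P. \<forall>q\<in>P. u p q = (if p = q then 1 else 0)"
      and sep: "\<forall>a\<in>B. (\<forall>p\<in>P. a p = 0) \<longrightarrow> a = 0"
    using ex by - (elim exE conjE, rule that)
  have "coord.dim B = card P"
    by (rule coord.dim_eq_card_dual_family[OF B finite, where u = u and \<chi> = "\<lambda>p a. a p"])
       (use uB dual sep in \<open>blast | simp\<close>)+
  moreover have "germ.dim (?F ` B) = card P"
  proof (rule germ.dim_eq_card_dual_family[where u = "\<lambda>p. ?F (u p)" and \<chi> = "\<lambda>p h. h p $$ e p / d p"])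
    show "germ.subspace (?F ` B)"
    proof (rule germ.subspaceI)
      have "0 = ?F 0"
        by (auto simp: fun_eq_iff monomial_germ_def)
      then show "0 \<in> ?F ` B"
        using coord.subspace_0[OF B] by (rule image_eqI)
    next
      fix x y assume "x \<in> ?F ` B" "y \<in> ?F ` B"
      then obtain r t where r: "x = ?F r" "r \<in> B" "y = ?F t" "t \<in> B"
        by blast
      then have "x + y = ?F (r + t)"
        by (auto simp: fun_eq_iff fls_eq_iff monomial_germ_nth algebra_simps)
      then show "x + y \<in> ?F ` B"
        using coord.subspace_add[OF B r(2,4)] by (rule image_eqI)
    next
      fix k :: complex and x assume "x \<in> ?F ` B"
      then obtain r where r: "x = ?F r" "r \<in> B"
        by blast
      then have "const_germ k * x = ?F (\<lambda>i. k * r i)"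
        by (auto simp: fun_eq_iff fls_eq_iff monomial_germ_nth const_germ_def algebra_simps)
      then show "const_germ k * x \<in> ?F ` B"
        using coord.subspace_scale[OF B r(2)] by (rule image_eqI)
    qed
    show "h = 0" if h: "h \<in> ?F ` B" and z: "\<And>p. p \<in> P \<Longrightarrow> h p $$ e p / d p = 0" for h
    proof -
      obtain a where a: "h = ?F a" "a \<in> B"
        using h by blast
      have "a p = 0" if "p \<in> P" for p
        using z[OF that] d[of p] by (simp add: a(1) monomial_germ_nth)
      then have "a = 0"
        using sep a(2) by blast
      then show ?thesis
        by (auto simp: a(1) fun_eq_iff monomial_germ_def)
    qed
  qed (use uB dual d in \<open>auto simp: const_germ_def monomial_germ_nth add_divide_distrib\<close>)
  ultimately show ?thesis by simp
qed

section \<open>The homogeneous generator and the residue pairing\<close>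

text \<open>
  With \<open>- b i\<close> as the weight of \<open>t\<^sub>i\<close>, the condition on the order of \<open>\<eta>\<close> says that its leading terms
  have the same weight \<open>l\<close> on all branches.
\<close>

locale graded_gorenstein_curve =
  fixes R :: "('b::finite) germ set" and b :: "'b \<Rightarrow> int" and l :: int and \<eta> :: "'b germ"
  assumes curve: "curve_singularity R"
    and act: "z \<noteq> 0 \<Longrightarrow> Gm_act (\<lambda>i. - b i) 0 z ` R \<subseteq> R"
    and gen: "dualizing_generator R \<eta>"
    and l_pos: "l > 0" and b_pos: "b i > 0" and b_dvd: "b i dvd l"
    and \<eta>_nz: "\<eta> i \<noteq> 0" and \<eta>_sub: "fls_subdegree (\<eta> i) = - (l div b i) - 1"
begin

lemma R_regular: "f \<in> R \<Longrightarrow> k < 0 \<Longrightarrow> f i $$ k = 0"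
proof -
  assume "f \<in> R" "k < 0"
  then have "f i \<in> range fps_to_fls"
    using curve by (auto simp: curve_singularity_def normalization_ring_def)
  then show ?thesis
    using \<open>k < 0\<close> by auto
qed

lemma R_const: "const_germ x \<in> R"
  using curve by (auto simp: curve_singularity_def)

lemma R_add: "f \<in> R \<Longrightarrow> g \<in> R \<Longrightarrow> f + g \<in> R"
  and R_mult: "f \<in> R \<Longrightarrow> g \<in> R \<Longrightarrow> f * g \<in> R"
  and R_value: "f \<in> R \<Longrightarrow> f i $$ 0 = f j $$ 0"
  using curve by (auto simp: curve_singularity_def)

lemma R_zero: "0 \<in> R" and R_one: "1 \<in> R"
  using R_const[of 0] R_const[of 1] by (simp_all add: const_germ_def zero_fun_def one_fun_def)

lemma R_sum: "(\<And>x. x \<in> X \<Longrightarrow> f x \<in> R) \<Longrightarrow> sum f X \<in> R"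
  by (induction X rule: infinite_finite_induct) (auto intro: R_zero R_add)

lemma R_power: "f \<in> R \<Longrightarrow> f ^ n \<in> R"
  by (induction n) (auto intro: R_one R_mult)

text \<open>
  Writing \<open>u = 1 - x\<close>, the partial sums of the geometric series lie in \<open>R\<close>, and the remainder
  \<open>x\<^sup>n / u\<close> lies in the conductor for large \<open>n\<close>.
\<close>

lemma unit_inverse:
  assumes u: "u \<in> R" and u0: "\<And>i. u i $$ 0 = 1"
  shows "\<exists>v\<in>R. u * v = 1"
proof -
  obtain N :: int where N: "\<And>f. (\<And>i k. k < N \<Longrightarrow> f i $$ k = 0) \<Longrightarrow> f \<in> R"
    using curve unfolding curve_singularity_def by metis
  define x where "x = 1 + const_germ (-1) * u"
  have x: "x \<in> R"
    unfolding x_def by (intro R_add R_one R_mult R_const u)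
  have x_nth: "x i $$ k = 0" if "k < 1" for i k
    using that R_regular[OF u, of k i] u0[of i] by (cases "k = 0") (auto simp: x_def const_germ_def)
  have u_x: "u = 1 - x"
    by (simp add: x_def const_germ_def fun_eq_iff)
  have u_nz: "u i \<noteq> 0" for i
    using u0[of i] by auto
  define n where "n = nat N"
  have pow: "(x ^ n) i $$ k = 0" if "k < int n" for i k
    using that
  proof (induction n arbitrary: k)
    case 0
    then show ?case by (auto simp: one_fun_def)
  next
    case (Suc n)
    show ?case
    proof (cases "x i = 0 \<or> (x ^ n) i = 0")
      case True
      then show ?thesis by auto
    next
      case False
      then have "1 \<le> fls_subdegree (x i)" "int n \<le> fls_subdegree ((x ^ n) i)"
        using x_nth Suc.IH by (auto intro: fls_subdegree_geI)
      then show ?thesis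
        using Suc.prems by (auto intro: fls_times_nth_eq0)
    qed
  qed
  define r where "r = (\<lambda>i. (x ^ n) i / u i)"
  have "r \<in> R"
  proof (rule N)
    fix i k assume k: "k < N"
    have sub0: "fls_subdegree (u i) \<le> 0"
      using u0[of i] by (intro fls_subdegree_leI) simp
    show "r i $$ k = 0"
    proof (rule ccontr)
      assume nz: "r i $$ k \<noteq> 0"
      then have "r i \<noteq> 0" by auto
      have eq: "(x ^ n) i = r i * u i"
        using u_nz[of i] by (simp add: r_def)
      then have "(x ^ n) i \<noteq> 0"
        using u_nz[of i] \<open>r i \<noteq> 0\<close> by simp
      then have "int n \<le> fls_subdegree ((x ^ n) i)"
        using pow by (intro fls_subdegree_geI)
      also have "\<dots> = fls_subdegree (r i) + fls_subdegree (u i)"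
        unfolding eq using u_nz[of i] \<open>r i \<noteq> 0\<close> by simp
      also have "\<dots> \<le> fls_subdegree (r i)"
        using sub0 by simp
      also have "\<dots> \<le> k"
        using nz by (rule fls_subdegree_leI)
      finally show False
        using k by (simp add: n_def split: if_splits)
    qed
  qed
  define v where "v = (\<Sum>j<n. x ^ j) + r"
  have "v \<in> R"
    unfolding v_def by (intro R_add R_sum R_power x \<open>r \<in> R\<close>)
  moreover have "u * v = 1"
  proof -
    have "u * (\<Sum>j<n. x ^ j) = 1 - x ^ n"
      using one_diff_power_eq[of x n] by (simp add: u_x)
    moreover have "u * r = x ^ n"
      using u_nz by (auto simp: r_def fun_eq_iff)
    ultimately show ?thesis
      by (simp add: v_def distrib_left)
  qed
  ultimately show ?thesis by blast
qed

text \<open>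
  The sum is the residue pairing of the degree \<open>j\<close> component of \<open>f\<close> with \<open>\<alpha>\<close>.  It vanishes because
  the pairing of \<open>z \<cdot> f\<close> with \<open>\<alpha>\<close> is zero for all \<open>z\<close>, and it is a polynomial in \<open>1/z\<close> whose
  coefficients are these sums.
\<close>

lemma homogeneous_pairing:
  assumes f: "f \<in> R" and \<alpha>: "\<alpha> \<in> dualizing_module R"
  shows "(\<Sum>i\<in>UNIV. if b i dvd j then f i $$ (j div b i) * \<alpha> i $$ (- 1 - j div b i) else 0) = 0"
proof (cases "j < 0")
  case True
  then have "f i $$ (j div b i) = 0" for i
    using R_regular[OF f] div_neg_pos_less0[OF _ b_pos] by simp
  then show ?thesis
    by (simp cong: if_cong)
next
  case False
  define N where "N = Max (range (\<lambda>i. nat (- 1 - fls_subdegree (\<alpha> i))))"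
  have \<alpha>_low: "\<alpha> i $$ k = 0" if "k < - 1 - int N" for i k
  proof -
    have "nat (- 1 - fls_subdegree (\<alpha> i)) \<le> N"
      unfolding N_def by (intro Max_ge) auto
    then show ?thesis
      using that by (intro fls_eq0_below_subdegree) linarith
  qed
  define p where "p = (\<Sum>i\<in>UNIV. \<Sum>k\<le>N. monom (f i $$ int k * \<alpha> i $$ (- 1 - int k)) (nat (b i) * k))"
  have "poly p x = 0" if x: "x \<noteq> 0" for x
  proof -
    let ?g = "Gm_act (\<lambda>i. - b i) 0 (inverse x) f"
    have g: "?g \<in> R"
      using act[of "inverse x"] x f by auto
    have g_nth: "?g i $$ int k = x ^ (nat (b i) * k) * f i $$ int k" for i k
    proof -
      have "inverse x powi (- b i * int k) = x powi (int (nat (b i) * k))"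
        using b_pos[of i] by (simp add: power_int_inverse power_int_minus)
      then show ?thesis
        using x by (simp add: Gm_act_nth flip: power_int_of_nat)
    qed
    have "0 = (\<Sum>i\<in>UNIV. fls_residue (?g i * \<alpha> i))"
      using \<alpha> g by (simp add: dualizing_module_def)
    also have "\<dots> = (\<Sum>i\<in>UNIV. \<Sum>k\<le>N. ?g i $$ int k * \<alpha> i $$ (- 1 - int k))"
      unfolding fls_residue_def
      by (intro sum.cong refl, subst fls_mult_nth_of_bounds[where N = N])
         (simp_all add: R_regular[OF g] \<alpha>_low)
    also have "\<dots> = poly p x"
      by (simp add: p_def poly_sum poly_monom g_nth mult_ac)
    finally show ?thesis by simp
  qed
  then have "UNIV - {0} \<subseteq> {x. poly p x = 0}"
    by auto
  then have "infinite {x. poly p x = 0}"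
    using infinite_UNIV_char_0[where 'a = complex] by (meson finite_Diff2 finite.emptyI finite.insertI finite_subset)
  then have p0: "p = 0"
    using poly_roots_finite by blast
  have inner: "(\<Sum>k\<le>N. if nat (b i) * k = nat j then f i $$ int k * \<alpha> i $$ (- 1 - int k) else 0) =
      (if b i dvd j then f i $$ (j div b i) * \<alpha> i $$ (- 1 - j div b i) else 0)" for i
  proof -
    obtain B where B: "b i = int B" "B > 0"
      using b_pos[of i] by (metis of_nat_0_less_iff zero_less_imp_eq_int)
    obtain J where J: "j = int J"
      using False by (metis nonneg_int_cases not_less)
    have "B * k = J \<longleftrightarrow> B dvd J \<and> k = J div B" for k
      using B(2) by auto
    then have "(\<Sum>k\<le>N. if nat (b i) * k = nat j then f i $$ int k * \<alpha> i $$ (- 1 - int k) else 0) =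
        (\<Sum>k\<le>N. if k = J div B then if B dvd J then f i $$ int k * \<alpha> i $$ (- 1 - int k) else 0 else 0)"
      by (intro sum.cong refl) (auto simp: B J)
    also have "\<dots> = (if B dvd J then f i $$ int (J div B) * \<alpha> i $$ (- 1 - int (J div B)) else 0)"
      using \<alpha>_low[of "- 1 - int (J div B)" i] by (cases "J div B \<le> N") auto
    finally show ?thesis
      by (simp add: B J zdiv_int)
  qed
  have "0 = coeff p (nat j)"
    by (simp add: p0)
  also have "\<dots> = (\<Sum>i\<in>UNIV. \<Sum>k\<le>N. if nat (b i) * k = nat j then f i $$ int k * \<alpha> i $$ (- 1 - int k) else 0)"
    by (simp add: p_def coeff_sum)
  finally show ?thesis
    by (simp only: inner)
qed

definition lead :: "'b \<Rightarrow> complex" where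
  "lead i = \<eta> i $$ (- (l div b i) - 1)"

text \<open>
  The homogeneous component of weight \<open>l\<close> of \<open>\<eta>\<close>, which consists of the leading terms.
\<close>

definition \<eta>0 :: "'b germ" where
  "\<eta>0 = monomial_germ (\<lambda>i. - (l div b i) - 1) lead"

lemma lead_nz: "lead i \<noteq> 0"
  using nth_fls_subdegree_nonzero[OF \<eta>_nz[of i]] by (simp add: lead_def \<eta>_sub)

lemma dualizing_module_mult: "f \<in> R \<Longrightarrow> \<alpha> \<in> dualizing_module R \<Longrightarrow> f * \<alpha> \<in> dualizing_module R"
  using R_mult by (fastforce simp: dualizing_module_def simp flip: mult.assoc)

lemma \<eta>_in: "\<eta> \<in> dualizing_module R"
  using gen R_one by (auto simp: dualizing_generator_def intro!: image_eqI[of _ _ 1])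

lemma \<eta>0_in: "\<eta>0 \<in> dualizing_module R"
  unfolding dualizing_module_def
proof safe
  fix f assume f: "f \<in> R"
  have "(\<Sum>i\<in>UNIV. fls_residue (f i * \<eta>0 i)) = (\<Sum>i\<in>UNIV. if b i dvd l then
      f i $$ (l div b i) * \<eta> i $$ (- 1 - l div b i) else 0)"
    unfolding \<eta>0_def residue_times_monomial_germ
    by (intro sum.cong) (simp_all add: b_dvd lead_def minus_diff_commute)
  then show "(\<Sum>i\<in>UNIV. fls_residue (f i * \<eta>0 i)) = 0"
    using homogeneous_pairing[OF f \<eta>_in, of l] by simp
qed

text \<open>
  The factor by which \<open>\<eta>0\<close> differs from \<open>\<eta>\<close> has constant term \<open>1\<close>, because both have the same
  leading terms; so it is a unit of \<open>R\<close>.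
\<close>

lemma \<eta>0_generates: "dualizing_module R = (\<lambda>f. f * \<eta>0) ` R"
proof -
  obtain u where u: "u \<in> R" "\<eta>0 = u * \<eta>"
    using \<eta>0_in gen by (auto simp: dualizing_generator_def)
  have u0: "u i $$ 0 = 1" for i
  proof -
    have "lead i = \<eta>0 i $$ (- (l div b i) - 1)"
      by (simp add: \<eta>0_def monomial_germ_nth)
    also have "\<dots> = u i $$ 0 * lead i"
      unfolding u(2) times_fun_apply
      by (subst fls_mult_nth_of_bounds[where N = 0]) (auto simp: R_regular[OF u(1)] \<eta>_sub lead_def)
    finally show ?thesis
      using lead_nz[of i] by simp
  qed
  obtain v where v: "v \<in> R" "u * v = 1"
    using unit_inverse[OF u(1) u0] by blast
  show ?thesis
  proof
    show "dualizing_module R \<subseteq> (\<lambda>f. f * \<eta>0) ` R"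
    proof
      fix \<alpha> assume "\<alpha> \<in> dualizing_module R"
      then obtain f where f: "f \<in> R" "\<alpha> = f * \<eta>"
        using gen by (auto simp: dualizing_generator_def)
      have "(f * v) * \<eta>0 = f * (u * v) * \<eta>"
        by (simp only: u(2) mult_ac)
      then have "\<alpha> = (f * v) * \<eta>0"
        by (simp add: f(2) v(2))
      then show "\<alpha> \<in> (\<lambda>f. f * \<eta>0) ` R"
        using R_mult[OF f(1) v(1)] by blast
    qed
    show "(\<lambda>f. f * \<eta>0) ` R \<subseteq> dualizing_module R"
      using dualizing_module_mult \<eta>0_in by blast
  qed
qed

lemma mult_\<eta>0_in_iff: "f * \<eta>0 \<in> dualizing_module R \<longleftrightarrow> f \<in> R"
  using monomial_germ_cancel[of f _ lead] lead_nz by (auto simp: \<eta>0_generates \<eta>0_def)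

definition component :: "int \<Rightarrow> 'b germ \<Rightarrow> 'b \<Rightarrow> complex" where
  "component j f i = (if b i dvd j then f i $$ (j div b i) else 0)"

text \<open>
  The homogeneous functions of degree \<open>j\<close> (that is, of weight \<open>- j\<close>), as vectors of coefficients.  The
  division \<open>j div b i\<close> is exact wherever the coefficient is nonzero.
\<close>

definition graded_piece :: "int \<Rightarrow> ('b \<Rightarrow> complex) set" where
  "graded_piece j = {a. (\<forall>i. a i \<noteq> 0 \<longrightarrow> b i dvd j) \<and> monomial_germ (\<lambda>i. j div b i) a \<in> R}"

text \<open>
  The singularity contains the homogeneous components of its functions: by duality this may be
  tested against the dualizing module, where it is the vanishing of the homogeneous pairings.
\<close>

lemma component_in: "f \<in> R \<Longrightarrow> component j f \<in> graded_piece j"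
proof -
  assume f: "f \<in> R"
  have "monomial_germ (\<lambda>i. j div b i) (component j f) * \<eta>0 \<in> dualizing_module R"
    unfolding dualizing_module_def
  proof safe
    fix g assume g: "g \<in> R"
    have "(\<Sum>i\<in>UNIV. fls_residue (g i * (monomial_germ (\<lambda>i. j div b i) (component j f) * \<eta>0) i)) =
        (\<Sum>i\<in>UNIV. if b i dvd j then f i $$ (j div b i) * (g * \<eta>0) i $$ (- 1 - j div b i) else 0)"
    proof (intro sum.cong refl)
      fix i
      have "g i * (monomial_germ (\<lambda>i. j div b i) (component j f) * \<eta>0) i =
          (g * \<eta>0) i * monomial_germ (\<lambda>i. j div b i) (component j f) i"
        by (simp add: mult_ac)
      then show "fls_residue (g i * (monomial_germ (\<lambda>i. j div b i) (component j f) * \<eta>0) i) =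
          (if b i dvd j then f i $$ (j div b i) * (g * \<eta>0) i $$ (- 1 - j div b i) else 0)"
        by (simp only: residue_times_monomial_germ) (simp add: component_def)
    qed
    then show "(\<Sum>i\<in>UNIV. fls_residue (g i * (monomial_germ (\<lambda>i. j div b i) (component j f) * \<eta>0) i)) = 0"
      using homogeneous_pairing[OF f dualizing_module_mult[OF g \<eta>0_in]] by simp
  qed
  then show ?thesis
    by (simp add: mult_\<eta>0_in_iff graded_piece_def component_def)
qed

lemma component_monomial:
  "\<forall>i. a i \<noteq> 0 \<longrightarrow> b i dvd j \<Longrightarrow> component j (monomial_germ (\<lambda>i. j div b i) a) = a"
  by (auto simp: component_def monomial_germ_nth fun_eq_iff)

text \<open>
  For the duality, a homogeneous function \<open>g\<close> of degree \<open>l - j\<close> belongs to \<open>R\<close> iff \<open>g \<eta>0\<close> is dualizing,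
  and the residue pairing of \<open>g \<eta>0\<close> with a function only involves the component of degree \<open>j\<close> of
  that function.
\<close>

lemma graded_duality: "graded_duality b l lead graded_piece"
proof
  show "a \<in> graded_piece j \<Longrightarrow> a i \<noteq> 0 \<Longrightarrow> b i dvd j" for a j i
    by (simp add: graded_piece_def)
  show "coord.subspace (graded_piece j)" for j
  proof (rule coord.subspaceI)
    have "monomial_germ (\<lambda>i. j div b i) 0 = 0"
      by (simp add: monomial_germ_def fun_eq_iff)
    then show "0 \<in> graded_piece j"
      by (simp add: graded_piece_def R_zero)
  next
    fix x y assume xy: "x \<in> graded_piece j" "y \<in> graded_piece j"
    have "monomial_germ (\<lambda>i. j div b i) (x + y) =
        monomial_germ (\<lambda>i. j div b i) x + monomial_germ (\<lambda>i. j div b i) y"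
      by (auto simp: fun_eq_iff fls_eq_iff monomial_germ_nth)
    moreover have "b i dvd j" if "x i + y i \<noteq> 0" for i
      using that xy by (cases "x i = 0") (auto simp: graded_piece_def)
    ultimately show "x + y \<in> graded_piece j"
      using xy by (auto simp: graded_piece_def R_add)
  next
    fix k x assume x: "x \<in> graded_piece j"
    have "monomial_germ (\<lambda>i. j div b i) (\<lambda>i. k * x i) = const_germ k * monomial_germ (\<lambda>i. j div b i) x"
      by (auto simp: fun_eq_iff fls_eq_iff monomial_germ_nth const_germ_def)
    then show "(\<lambda>i. k * x i) \<in> graded_piece j"
      using x by (auto simp: graded_piece_def R_mult R_const)
  qed
  show "graded_piece j \<subseteq> {0}" if "j < 0" for j
  proof
    fix a assume a: "a \<in> graded_piece j"
    have "a i = 0" for i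
    proof -
      have "j div b i < 0"
        using that b_pos by (rule div_neg_pos_less0)
      then show ?thesis
        using a R_regular[of "monomial_germ (\<lambda>i. j div b i) a" "j div b i" i]
        by (simp add: graded_piece_def monomial_germ_nth)
    qed
    then show "a \<in> {0}"
      by (simp add: fun_eq_iff)
  qed
  show "graded_piece 0 = range (\<lambda>x i. x)"
  proof safe
    fix a assume "a \<in> graded_piece 0"
    then have "monomial_germ (\<lambda>i. 0) a \<in> R"
      by (simp add: graded_piece_def)
    then have "a i = a j" for i j
      using R_value[of "monomial_germ (\<lambda>i. 0) a" i j] by (simp add: monomial_germ_nth)
    then have "a = (\<lambda>i. a undefined)"
      by auto
    then show "a \<in> range (\<lambda>x i. x)"
      by (rule range_eqI)
  next
    fix x
    have "monomial_germ (\<lambda>i. 0) (\<lambda>i::'b. x) = const_germ x"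
      by (simp add: monomial_germ_def const_germ_def fun_eq_iff)
    then show "(\<lambda>i. x) \<in> graded_piece 0"
      by (simp add: graded_piece_def R_const)
  qed
  show "graded_piece (l - j) = {a. (\<forall>i. a i \<noteq> 0 \<longrightarrow> b i dvd j) \<and> (\<forall>v\<in>graded_piece j. (\<Sum>i\<in>UNIV. lead i * a i * v i) = 0)}" for j
  proof -
    have dvd: "b i dvd l - j \<longleftrightarrow> b i dvd j" for i
      using dvd_diff_right_iff[OF b_dvd[of i], of j] by (simp add: dvd_diff_commute)
    have "monomial_germ (\<lambda>i. (l - j) div b i) a \<in> R \<longleftrightarrow> (\<forall>v\<in>graded_piece j. (\<Sum>i\<in>UNIV. lead i * a i * v i) = 0)"
      if a: "\<forall>i. a i \<noteq> 0 \<longrightarrow> b i dvd j" for a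
    proof -
      let ?g = "monomial_germ (\<lambda>i. (l - j) div b i) a"
      have prod: "?g * \<eta>0 = monomial_germ (\<lambda>i. - 1 - j div b i) (\<lambda>i. a i * lead i)"
      proof -
        have "(l - j) div b i = l div b i - j div b i" if "a i \<noteq> 0" for i
          using a that b_dvd[of i] by (simp add: div_diff)
        then have "(l - j) div b i + (- (l div b i) - 1) = - 1 - j div b i" if "a i \<noteq> 0" for i
          using that by simp
        then show ?thesis
          unfolding \<eta>0_def monomial_germ_mult fun_eq_iff fls_eq_iff monomial_germ_nth
          by (metis mult_eq_0_iff)
      qed
      have pair: "(\<Sum>i\<in>UNIV. fls_residue (f i * (?g * \<eta>0) i)) =
          (\<Sum>i\<in>UNIV. lead i * a i * component j f i)" for f
      proof (intro sum.cong refl)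
        fix i
        show "fls_residue (f i * (?g * \<eta>0) i) = lead i * a i * component j f i"
          unfolding prod residue_times_monomial_germ using a by (auto simp: component_def)
      qed
      have "?g \<in> R \<longleftrightarrow> (\<forall>f\<in>R. (\<Sum>i\<in>UNIV. lead i * a i * component j f i) = 0)"
        unfolding mult_\<eta>0_in_iff[symmetric] dualizing_module_def by (simp only: mem_Collect_eq pair)
      also have "\<dots> \<longleftrightarrow> (\<forall>v\<in>graded_piece j. (\<Sum>i\<in>UNIV. lead i * a i * v i) = 0)"
      proof safe
        fix v assume all: "\<forall>f\<in>R. (\<Sum>i\<in>UNIV. lead i * a i * component j f i) = 0" and v: "v \<in> graded_piece j"
        have "component j (monomial_germ (\<lambda>i. j div b i) v) = v"
          using v by (intro component_monomial) (simp add: graded_piece_def)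
        then show "(\<Sum>i\<in>UNIV. lead i * a i * v i) = 0"
          using all v by (auto simp: graded_piece_def)
      qed (use component_in in blast)
      finally show ?thesis .
    qed
    then show ?thesis
      unfolding graded_piece_def[of "l - j"] dvd by (intro Collect_cong) blast
  qed
qed (fact l_pos b_pos b_dvd lead_nz)+

lemma dualizing_power_eq: "dualizing_power R m = (\<lambda>f. f * \<eta>0 ^ m) ` R"
proof (induction m)
  case 0
  show ?case by simp
next
  case (Suc m)
  show ?case
  proof
    show "dualizing_power R (Suc m) \<subseteq> (\<lambda>f. f * \<eta>0 ^ Suc m) ` R"
    proof
      fix h assume "h \<in> dualizing_power R (Suc m)"
      then obtain N :: nat and \<alpha> \<beta> where h: "h = (\<Sum>j<N. \<alpha> j * \<beta> j)"
          and \<alpha>\<beta>: "\<forall>j<N. \<alpha> j \<in> dualizing_module R \<and> \<beta> j \<in> dualizing_power R m"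
        by auto
      have "\<forall>j<N. \<exists>f. f \<in> R \<and> \<alpha> j * \<beta> j = f * \<eta>0 ^ Suc m"
      proof safe
        fix j assume "j < N"
        then obtain f g where f: "f \<in> R" "\<alpha> j = f * \<eta>0" and g: "g \<in> R" "\<beta> j = g * \<eta>0 ^ m"
          using \<alpha>\<beta> Suc.IH \<eta>0_generates by blast
        then have "\<alpha> j * \<beta> j = (f * g) * \<eta>0 ^ Suc m"
          by (simp add: mult_ac)
        then show "\<exists>f. f \<in> R \<and> \<alpha> j * \<beta> j = f * \<eta>0 ^ Suc m"
          using R_mult[OF f(1) g(1)] by blast
      qed
      then obtain f where f: "\<forall>j<N. f j \<in> R \<and> \<alpha> j * \<beta> j = f j * \<eta>0 ^ Suc m"
        by metis
      then have "h = (\<Sum>j<N. f j) * \<eta>0 ^ Suc m"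
        unfolding h sum_distrib_right by (intro sum.cong) auto
      moreover have "(\<Sum>j<N. f j) \<in> R"
        using f by (intro R_sum) auto
      ultimately show "h \<in> (\<lambda>f. f * \<eta>0 ^ Suc m) ` R"
        by blast
    qed
    show "(\<lambda>f. f * \<eta>0 ^ Suc m) ` R \<subseteq> dualizing_power R (Suc m)"
    proof safe
      fix f assume f: "f \<in> R"
      have "f * \<eta>0 ^ Suc m = (\<Sum>j<1::nat. \<eta>0 * (f * \<eta>0 ^ m))"
        by (simp add: mult_ac)
      moreover have "f * \<eta>0 ^ m \<in> dualizing_power R m"
        using f Suc.IH by blast
      ultimately show "f * \<eta>0 ^ Suc m \<in> dualizing_power R (Suc m)"
        using \<eta>0_in unfolding dualizing_power.simps mem_Collect_eq
        by (intro exI[of _ "1::nat"] exI[of _ "\<lambda>_. \<eta>0"] exI[of _ "\<lambda>_. f * \<eta>0 ^ m"] conjI) auto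
    qed
  qed
qed

text \<open>
  Division by \<open>\<eta>0\<^sup>m\<close> identifies differentials of weight \<open>k\<close> with functions of degree \<open>m l - k\<close>.  After
  multiplication by \<open>b i\<close>, the bound on the pole at infinity turns into a bound on the weight.
\<close>

lemma weight_multiplicity_eq:
  "weight_multiplicity (\<lambda>i. - b i) m {h \<in> dualizing_power R m. pole_order_at_infinity_le m p h} k =
    bounded_pole_dim b l graded_piece (int m) (int m - int p) k"
proof -
  define j where "j = int m * l - k"
  define e where "e = (\<lambda>i. int m * (- (l div b i) - 1))"
  define B where "B = {a \<in> graded_piece j. \<forall>i. a i \<noteq> 0 \<longrightarrow> (int m - int p) * b i \<le> k}"
  interpret G: graded_duality b l lead graded_piece by (rule graded_duality)
  let ?F = "\<lambda>a. monomial_germ (\<lambda>i. j div b i + e i) (\<lambda>i. a i * lead i ^ m)"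
  have pow: "\<eta>0 ^ m = monomial_germ e (\<lambda>i. lead i ^ m)"
    by (simp add: \<eta>0_def monomial_germ_power e_def)
  have lb: "b i * (l div b i) = l" for i
    using b_dvd[of i] by simp
  have weight: "- b i * (s + e i + int m) = k \<longleftrightarrow> b i * s = j" for i s
  proof -
    have "- b i * (s + e i + int m) = int m * (b i * (l div b i)) - b i * s"
      by (simp add: e_def algebra_simps)
    then show ?thesis
      by (auto simp: lb j_def)
  qed
  have pole: "- (s + e i) - 2 * int m \<ge> - int p \<longleftrightarrow> (int m - int p) * b i \<le> k" if "b i * s = j" for i s
  proof -
    have "- (s + e i) - 2 * int m \<ge> - int p \<longleftrightarrow> 0 \<le> b i * (- (s + e i) - 2 * int m + int p)"
      using b_pos[of i] by (auto simp: zero_le_mult_iff)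
    also have "b i * (- (s + e i) - 2 * int m + int p) =
        int m * (b i * (l div b i)) - b i * s - (int m - int p) * b i"
      by (simp add: e_def algebra_simps)
    finally show ?thesis
      by (simp add: lb that j_def)
  qed
  have "weight_space (\<lambda>i. - b i) m {h \<in> dualizing_power R m. pole_order_at_infinity_le m p h} k = ?F ` B"
    (is "?W = _")
  proof safe
    fix h assume "h \<in> ?W"
    then have h: "h \<in> dualizing_power R m" "pole_order_at_infinity_le m p h"
        "\<And>i s. h i $$ s \<noteq> 0 \<Longrightarrow> - b i * (s + int m) = k"
      by (auto simp: weight_space_iff)
    obtain f where f: "f \<in> R" "h = f * \<eta>0 ^ m"
      using h(1) dualizing_power_eq by blast
    have h_nth: "h i $$ (s + e i) = lead i ^ m * f i $$ s" for i s
      by (simp add: f(2) pow monomial_germ_times_nth)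
    have fs: "b i * s = j \<and> (int m - int p) * b i \<le> k" if "f i $$ s \<noteq> 0" for i s
    proof -
      have nz: "h i $$ (s + e i) \<noteq> 0"
        using that lead_nz[of i] by (simp add: h_nth)
      then have bs: "b i * s = j"
        using h(3)[OF nz] weight[of i s] by simp
      moreover have "- (s + e i) - 2 * int m \<ge> - int p"
        using h(2) nz unfolding pole_order_at_infinity_le_def by blast
      ultimately show ?thesis
        using pole[OF bs] by simp
    qed
    have div: "s = j div b i" if "b i * s = j" for i s
      using that b_pos[of i] by auto
    have f_eq: "f = monomial_germ (\<lambda>i. j div b i) (component j f)"
    proof (intro ext fls_eqI)
      fix i s
      show "f i $$ s = monomial_germ (\<lambda>i. j div b i) (component j f) i $$ s"
      proof (cases "b i * s = j")
        case True
        then have "b i dvd j" "s = j div b i"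
          using div by auto
        then show ?thesis
          by (simp add: monomial_germ_nth component_def)
      next
        case False
        then have "f i $$ s = 0" "\<not> (b i dvd j \<and> s = j div b i)"
          using fs[of i s] by auto
        then show ?thesis
          by (auto simp: monomial_germ_nth component_def)
      qed
    qed
    have "component j f \<in> B"
      using component_in[OF f(1)] fs by (auto simp: B_def component_def split: if_splits)
    moreover have "h = ?F (component j f)"
      by (subst f(2), subst f_eq) (simp add: pow monomial_germ_mult)
    ultimately show "h \<in> ?F ` B"
      by blast
  next
    fix a assume a: "a \<in> B"
    then have aR: "monomial_germ (\<lambda>i. j div b i) a \<in> R"
      by (simp add: B_def graded_piece_def)
    have "?F a = monomial_germ (\<lambda>i. j div b i) a * \<eta>0 ^ m"
      by (simp add: pow monomial_germ_mult)
    then have "?F a \<in> dualizing_power R m"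
      using aR by (auto simp: dualizing_power_eq)
    moreover have "- b i * (s + int m) = k \<and> - s - 2 * int m \<ge> - int p" if "?F a i $$ s \<noteq> 0" for i s
    proof -
      have s: "s = j div b i + e i" and "a i \<noteq> 0"
        using that by (auto simp: monomial_germ_nth split: if_splits)
      then have "b i * (j div b i) = j" "(int m - int p) * b i \<le> k"
        using a by (auto simp: B_def graded_piece_def)
      then show ?thesis
        unfolding s using weight[of i "j div b i"] pole[of i "j div b i"] by simp
    qed
    ultimately show "?F a \<in> ?W"
      by (auto simp: weight_space_iff pole_order_at_infinity_le_def)
  qed
  moreover have "coord.subspace B"
  proof (rule coord.subspaceI)
    show "0 \<in> B"
      using coord.subspace_0[OF G.A_sub] by (simp add: B_def)
  next
    fix x y assume xy: "x \<in> B" "y \<in> B"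
    have "(int m - int p) * b i \<le> k" if "x i + y i \<noteq> 0" for i
      using that xy by (cases "x i = 0") (auto simp: B_def)
    then show "x + y \<in> B"
      using xy coord.subspace_add[OF G.A_sub] by (auto simp: B_def)
  next
    fix t x assume "x \<in> B"
    then show "(\<lambda>i. t * x i) \<in> B"
      using coord.subspace_scale[OF G.A_sub] by (auto simp: B_def)
  qed
  ultimately show ?thesis
    using dim_monomial_image[of B "\<lambda>i. lead i ^ m" "\<lambda>i. j div b i + e i"] lead_nz
    by (simp add: weight_multiplicity_def bounded_pole_dim_def B_def j_def)
qed

end

section \<open>Signs of the weights and conclusion\<close>

lemma regular_mult_nth:
  fixes f g :: "complex fls"
  assumes "\<And>k. k < 0 \<Longrightarrow> f $$ k = 0" and "\<And>k. k < 0 \<Longrightarrow> g $$ k = 0" and "n < 0"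
  shows "(f * g) $$ n = 0"
proof (cases "f = 0 \<or> g = 0")
  case False
  then have "0 \<le> fls_subdegree f" "0 \<le> fls_subdegree g"
    using assms by (auto intro: fls_subdegree_geI)
  then show ?thesis
    using assms(3) by (intro fls_times_nth_eq0) simp
qed auto

text \<open>
  The dualizing module contains the differential that is \<open>dt\<^sub>i\<close> on the branch \<open>i\<close> and zero on the
  others.
\<close>

lemma dualizing_generator_nonzero:
  assumes R: "curve_singularity R" and gen: "dualizing_generator R \<eta>"
  shows "\<eta> i \<noteq> 0"
proof -
  let ?e = "monomial_germ (\<lambda>_. 0) (\<lambda>j. if j = i then 1 else 0)"
  have "?e \<in> dualizing_module R"
    unfolding dualizing_module_def
  proof safe
    fix f assume "f \<in> R"
    then have "f j \<in> range fps_to_fls" for j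
      using R by (auto simp: curve_singularity_def normalization_ring_def)
    then have "f j $$ -1 = 0" for j
      by (metis fps_to_fls_nth imageE less_minus_one_simps(1))
    then show "(\<Sum>j\<in>UNIV. fls_residue (f j * ?e j)) = 0"
      unfolding residue_times_monomial_germ by simp
  qed
  then obtain f where "?e = f * \<eta>"
    using gen by (auto simp: dualizing_generator_def)
  moreover have "?e i $$ 0 \<noteq> 0"
    by (simp add: monomial_germ_nth)
  ultimately show ?thesis
    by auto
qed

text \<open>
  Otherwise the dualizing module would consist of regular differentials only.  But then every regular
  function times \<open>\<eta>\<close> is regular, hence dualizing, hence a multiple of \<open>\<eta>\<close> by an element of \<open>R\<close>, and the
  point would be smooth.
\<close>

lemma dualizing_generator_not_regular:
  assumes R: "curve_singularity R" and gen: "dualizing_generator R \<eta>"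
  shows "\<exists>i. fls_subdegree (\<eta> i) < 0"
proof (rule ccontr)
  assume "\<nexists>i. fls_subdegree (\<eta> i) < 0"
  then have \<eta>_reg: "\<eta> i $$ k = 0" if "k < 0" for i k
    using that by (intro fls_eq0_below_subdegree) (meson less_le_trans not_less)
  have reg: "f i $$ k = 0" if "f \<in> normalization_ring" "k < 0" for f :: "'a germ" and i k
  proof -
    have "f i \<in> range fps_to_fls"
      using that by (simp add: normalization_ring_def)
    then show ?thesis
      using that by auto
  qed
  have RN: "R \<subseteq> normalization_ring"
    using R by (simp add: curve_singularity_def)
  have "normalization_ring \<subseteq> R"
  proof
    fix g :: "'a germ" assume g: "g \<in> normalization_ring"
    have "g * \<eta> \<in> dualizing_module R"
      unfolding dualizing_module_def
    proof safe
      fix f assume "f \<in> R"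
      then have f: "f \<in> normalization_ring"
        using RN by blast
      have "(f i * (g i * \<eta> i)) $$ -1 = 0" for i
        by (intro regular_mult_nth reg[OF f] reg[OF g] \<eta>_reg) auto
      then show "(\<Sum>i\<in>UNIV. fls_residue (f i * (g * \<eta>) i)) = 0"
        by simp
    qed
    then obtain f where f: "f \<in> R" "g * \<eta> = f * \<eta>"
      using gen by (auto simp: dualizing_generator_def)
    have "g i = f i" for i
      using fun_cong[OF f(2), of i] dualizing_generator_nonzero[OF R gen, of i] by simp
    then have "g = f" by blast
    then show "g \<in> R"
      using f by simp
  qed
  then show False
    using RN R by (auto simp: curve_singularity_def)
qed

text \<open>
  High powers of \<open>t\<^sub>i\<close> lie in the conductor, and their weights are multiples of \<open>w i\<close>.
\<close>

lemma weights_same_sign: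
  assumes R: "curve_singularity R" and good: "good_Gm_action R w"
  shows "(\<forall>i. w i > 0) \<or> (\<forall>i. w i < 0)"
proof -
  obtain N :: int where N: "\<And>f. (\<And>i k. k < N \<Longrightarrow> f i $$ k = 0) \<Longrightarrow> f \<in> R"
    using R unfolding curve_singularity_def by metis
  define n where "n = max N 1"
  have "weight_space w 0 (max_ideal R) (w i * n) \<noteq> {0}" for i
  proof -
    let ?f = "monomial_germ (\<lambda>_. n) (\<lambda>j. if j = i then 1 else 0)"
    have "?f \<in> R"
      by (intro N) (simp add: monomial_germ_nth n_def)
    then have "?f \<in> weight_space w 0 (max_ideal R) (w i * n)"
      by (auto simp: weight_space_iff max_ideal_def monomial_germ_nth n_def split: if_splits)
    moreover have "?f i $$ n \<noteq> 0 $$ n"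
      by (simp add: monomial_germ_nth)
    then have "?f \<noteq> 0"
      by (metis zero_fun_apply)
    ultimately show ?thesis by blast
  qed
  then have "(\<forall>i. w i * n > 0) \<or> (\<forall>i. w i * n < 0)"
    using good unfolding good_Gm_action_def by blast
  moreover have "n > 0" by (simp add: n_def)
  ultimately show ?thesis
    by (simp add: zero_less_mult_iff mult_less_0_iff)
qed

text \<open>
  The scaling convention makes all leading terms of the generator homogeneous of the same weight.
  That \<open>b i\<close> and \<open>l\<close> are positive is a matter of signs: weights of the opposite sign would force the
  generator to be regular, and a node would have weights zero.
\<close>

lemma graded_gorenstein_curve_exists:
  assumes R: "curve_singularity R" and good: "good_Gm_action R w" and "scaling_convention R w"
  shows "\<exists>b l \<eta>. graded_gorenstein_curve R b l \<eta> \<and> w = (\<lambda>i. - b i)"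
proof -
  obtain \<eta> where gen: "dualizing_generator R \<eta>"
      and w: "\<And>i. w i = - (Lcm (range (\<lambda>i. branch_order \<eta> i + 1)) div (branch_order \<eta> i + 1))"
    using assms(3) unfolding scaling_convention_def Let_def by blast
  define l where "l = Lcm (range (\<lambda>i. branch_order \<eta> i + 1))"
  define b where "b = (\<lambda>i. - w i)"
  have l: "branch_order \<eta> i + 1 dvd l" "l \<ge> 0" for i
    by (auto simp: l_def)
  have b: "b i = l div (branch_order \<eta> i + 1)" for i
    by (simp add: b_def w l_def)
  have "\<not> (\<forall>i. w i > 0)"
  proof
    assume pos: "\<forall>i. w i > 0"
    have "fls_subdegree (\<eta> i) \<ge> 0" for i
    proof -
      have "l div (branch_order \<eta> i + 1) < 0"
        using pos b[of i] by (simp add: b_def minus_equation_iff flip: b)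
      then have "branch_order \<eta> i + 1 < 0"
        using l(2) pos_imp_zdiv_nonneg_iff[of "branch_order \<eta> i + 1" l]
        by (cases "branch_order \<eta> i + 1" "0::int" rule: linorder_cases) auto
      then show ?thesis
        by (simp add: branch_order_def)
    qed
    then show False
      using dualizing_generator_not_regular[OF R gen] by (auto simp: not_le[symmetric])
  qed
  then have b_pos: "b i > 0" for i
    using weights_same_sign[OF R good] by (auto simp: b_def)
  have mult: "b i * (branch_order \<eta> i + 1) = l" for i
    unfolding b using l(1)[of i] by (rule dvd_div_mult_self)
  have "l \<noteq> 0"
  proof
    assume "l = 0"
    then have "b undefined = 0"
      unfolding b by simp
    then show False
      using b_pos[of undefined] by simp
  qed
  then have l_pos: "l > 0"
    using l(2) by simp
  have "graded_gorenstein_curve R b l \<eta>"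
  proof
    show "Gm_act (\<lambda>i. - b i) 0 z ` R \<subseteq> R" if "z \<noteq> 0" for z
      using good that by (simp add: good_Gm_action_def b_def)
    show "b i dvd l" for i
      using dvd_triv_left[of "b i" "branch_order \<eta> i + 1"] by (simp only: mult)
    show "fls_subdegree (\<eta> i) = - (l div b i) - 1" for i
    proof -
      have "l div b i = branch_order \<eta> i + 1"
        using b_pos[of i] nonzero_mult_div_cancel_left[of "b i" "branch_order \<eta> i + 1"]
        by (simp only: mult)
      then show ?thesis
        by (simp add: branch_order_def)
    qed
  qed (fact R gen l_pos b_pos dualizing_generator_nonzero[OF R gen])+
  then show ?thesis
    by (intro exI[of _ b] exI[of _ l] exI[of _ \<eta>]) (simp add: b_def)
qed

theorem theorem1p4:
  fixes R :: "('a::finite) germ set" and w :: "'a \<Rightarrow> int"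
    and R' :: "('b::finite) germ set" and w' :: "'b \<Rightarrow> int"
  assumes "smoothable_gorenstein_Gm R w"
    and "smoothable_gorenstein_Gm R' w'"
  shows "(weight_multiplicity w 1 (differentials R 1) =
           weight_multiplicity w' 1 (differentials R' 1) \<longrightarrow>
         (\<forall>m\<ge>2. weight_multiplicity w m (differentials R m) =
           weight_multiplicity w' m (differentials R' m))) \<and>
         (weight_multiplicity w 1 (log_differentials R 1) =
           weight_multiplicity w' 1 (log_differentials R' 1) \<longrightarrow>
         (\<forall>m\<ge>2. weight_multiplicity w m (log_differentials R m) =
           weight_multiplicity w' m (log_differentials R' m)))"
proof -
  obtain b l \<eta> where X: "graded_gorenstein_curve R b l \<eta>" and w: "w = (\<lambda>i. - b i)"
    using graded_gorenstein_curve_exists assms(1) unfolding smoothable_gorenstein_Gm_def by blast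
  obtain b' l' \<eta>' where Y: "graded_gorenstein_curve R' b' l' \<eta>'" and w': "w' = (\<lambda>i. - b' i)"
    using graded_gorenstein_curve_exists assms(2) unfolding smoothable_gorenstein_Gm_def by blast
  interpret X: graded_gorenstein_curve R b l \<eta> by (fact X)
  interpret Y: graded_gorenstein_curve R' b' l' \<eta>' by (fact Y)
  have regular: "weight_multiplicity w m (differentials R m) k = bounded_pole_dim b l X.graded_piece (int m) (int m) k"
      "weight_multiplicity w' m (differentials R' m) k = bounded_pole_dim b' l' Y.graded_piece (int m) (int m) k" for m k
    using X.weight_multiplicity_eq[of m 0 k] Y.weight_multiplicity_eq[of m 0 k]
    by (simp_all add: w w' differentials_def)
  have log: "weight_multiplicity w m (log_differentials R m) k = bounded_pole_dim b l X.graded_piece (int m) 0 k"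
      "weight_multiplicity w' m (log_differentials R' m) k = bounded_pole_dim b' l' Y.graded_piece (int m) 0 k" for m k
    using X.weight_multiplicity_eq[of m m k] Y.weight_multiplicity_eq[of m m k]
    by (simp_all add: w w' log_differentials_def)
  show ?thesis
  proof (intro conjI impI allI ext)
    fix m :: nat and k
    assume eq: "weight_multiplicity w 1 (differentials R 1) = weight_multiplicity w' 1 (differentials R' 1)"
      and "2 \<le> m"
    have one: "bounded_pole_dim b l X.graded_piece 1 1 k = bounded_pole_dim b' l' Y.graded_piece 1 1 k" for k
      using fun_cong[OF eq, of k] by (simp only: regular of_nat_1)
    have "int m \<ge> 2"
      using \<open>2 \<le> m\<close> by simp
    then show "weight_multiplicity w m (differentials R m) k = weight_multiplicity w' m (differentials R' m) k"
      unfolding regular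
      by (rule regular_dims_determined[OF X.graded_duality Y.graded_duality one])
  next
    fix m :: nat and k
    assume eq: "weight_multiplicity w 1 (log_differentials R 1) = weight_multiplicity w' 1 (log_differentials R' 1)"
    have one: "bounded_pole_dim b l X.graded_piece 1 0 k = bounded_pole_dim b' l' Y.graded_piece 1 0 k" for k
      using fun_cong[OF eq, of k] by (simp only: log of_nat_1)
    show "weight_multiplicity w m (log_differentials R m) k = weight_multiplicity w' m (log_differentials R' m) k"
      unfolding log by (rule log_dims_determined[OF X.graded_duality Y.graded_duality one])
  qed
qed

end
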